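(* Let $\mathfrak h$ be the 3-dimensional Heisenberg Lie algebra over a field $\mathbb K$ of characteristic zero. As a Lie algebra (with the Poisson bracket), $H_E^{\bullet,\bullet}(\mathfrak h)=\bigoplus_{p+q\text{ even}}H^p(\mathfrak h,\bigwedge^q\mathfrak h)$ is isomorphic to the semidirect product $\mathfrak{gl}(3,\mathbb K)\ltimes\mathfrak{gl}(3,\mathbb K)_{ab}$, where $\mathfrak{gl}(3,\mathbb K)_{ab}$ is the vector space $\mathfrak{gl}(3,\mathbb K)$ viewed as an abelian Lie algebra on which $\mathfrak{gl}(3,\mathbb K)$ acts by the adjoint representation.
   Context: $\mathfrak h$ has basis $x_1,x_{-1},h_0$ with only nonzero bracket $[x_1,x_{-1}]=h_0$ (up to skew-symmetry). Let $C^{p,q}=\bigwedge^p\mathfrak h^*\otimes\bigwedge^q\mathfrak h$, with product $(\phi\otimes v)\vee(\psi\otimes w)=(-1)^{p_2q_1}\,\phi\wedge\psi\otimes v\wedge w$ for $\phi\otimes v\in C^{p_1,q_1}$, $\psi\otimes w\in C^{p_2,q_2}$. $C^{\bullet,\bullet}$ is a Poisson superalgebra (parity of $C^{p,q}$ is $p+q$) with super-bracket $\{-,-\}:C^{p_1,q_1}\times C^{p_2,q_2}\to C^{p_1+p_2-1,q_1+q_2-1}$ determined by: $\{\mathfrak h,\mathfrak h\}=\{\mathfrak h^*,\mathfrak h^*\}=0$; $\{\phi,v\}=\{v,\phi\}=\phi(v)$ for $\phi\in\mathfrak h^*$, $v\in\mathfrak h$; $\{a,b\}=-(-1)^{(p_1+q_1)(p_2+q_2)}\{b,a\}$;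 and $\{a\vee b,c\}=a\vee\{b,c\}+(-1)^{(p_1+q_1)(p_2+q_2)}b\vee\{a,c\}$, for $a\in C^{p_1,q_1}$, $b\in C^{p_2,q_2}$. Let $\mu\in C^{2,1}=\bigwedge^2\mathfrak h^*\otimes\mathfrak h$ be the Lie bracket of $\mathfrak h$; the Chevalley–Eilenberg differential computing $H^p(\mathfrak h,\bigwedge^q\mathfrak h)$ (coefficients in the exterior powers of the adjoint module) is $d=\{\mu,-\}:C^{p,q}\to C^{p+1,q}$. The product and the bracket descend to cohomology, and the even part $H_E^{\bullet,\bullet}(\mathfrak h)$ is a Poisson algebra, in particular a Lie algebra under $\{-,-\}$. *)

theory Defs
  imports "HOL-Analysis.Analysis" "HOL-Library.Set_Algebras"
begin

section \<open>The Poisson superalgebra of a vector space with ordered basis\<close>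

text \<open>
  Throughout, \<^typ>\<open>'k ^ 'i\<close> is the vector space \<open>h\<close> with basis indexed by \<^typ>\<open>'i\<close>, and also its
  dual, in coordinates with respect to the dual basis. The exterior algebra of either is spanned by
  the monomials \<open>e\<^sub>I = e\<^sub>i\<^sub>1 \<and> \<dots> \<and> e\<^sub>i\<^sub>p\<close> for \<open>I = {i\<^sub>1 < \<dots> < i\<^sub>p}\<close>, so it is modelled by coordinate
  vectors indexed by subsets of \<^typ>\<open>'i\<close>; elements of the tensor product are coordinate vectors
  indexed by pairs of subsets, the first component belonging to the dual.
\<close>

type_synonym ('k, 'i) ext = "('k, 'i set) vec"
type_synonym ('k, 'i) cochain = "('k, 'i set \<times> 'i set) vec"

text \<open>\<open>e\<^sub>I \<and> e\<^sub>J = ext_sign I J e\<^bsub>I \<union> J\<^esub>\<close>, the sign being that of the permutation sorting \<open>I\<close> followed by \<open>J\<close>.\<close>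

definition ext_sign :: "'i::linorder set \<Rightarrow> 'i set \<Rightarrow> 'k::field" where
  "ext_sign I J = (if I \<inter> J = {} then (-1) ^ card {(i, j). i \<in> I \<and> j \<in> J \<and> j < i} else 0)"

definition wedge :: "('k::field, 'i::{finite,linorder}) ext \<Rightarrow> ('k, 'i) ext \<Rightarrow> ('k, 'i) ext" where
  "wedge a b = (\<Sum>I\<in>UNIV. \<Sum>J\<in>UNIV. (a $ I * b $ J * ext_sign I J) *s axis (I \<union> J) 1)"

definition tensor :: "('k::field, 'i::finite) ext \<Rightarrow> ('k, 'i) ext \<Rightarrow> ('k, 'i) cochain" where
  "tensor \<phi> v = (\<chi> s. \<phi> $ fst s * v $ snd s)"

text \<open>Bidegrees are integers, so that \<open>C p q\<close> is zero if \<open>p\<close> or \<open>q\<close> is negative.\<close>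

definition cochains :: "int \<Rightarrow> int \<Rightarrow> ('k::field, 'i::finite) cochain set" where
  "cochains p q = {c. \<forall>I J. c $ (I, J) \<noteq> 0 \<longrightarrow> int (card I) = p \<and> int (card J) = q}"

text \<open>
  Bilinear extension from tensors of monomials; the formula for arbitrary homogeneous pure tensors is
  \<open>vee_tensor\<close> below.
\<close>

definition vee :: "('k::field, 'i::{finite,linorder}) cochain \<Rightarrow> ('k, 'i) cochain \<Rightarrow> ('k, 'i) cochain"
    (infixl \<open>\<or>\<^sub>C\<close> 70) where
  "a \<or>\<^sub>C b = (\<Sum>(I\<^sub>1, J\<^sub>1)\<in>UNIV. \<Sum>(I\<^sub>2, J\<^sub>2)\<in>UNIV.
     (a $ (I\<^sub>1, J\<^sub>1) * b $ (I\<^sub>2, J\<^sub>2) * (-1) ^ (card I\<^sub>2 * card J\<^sub>1)) *s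
     tensor (wedge (axis I\<^sub>1 1) (axis I\<^sub>2 1)) (wedge (axis J\<^sub>1 1) (axis J\<^sub>2 1)))"

definition covec_cochain :: "'k ^ 'i \<Rightarrow> ('k::field, 'i::finite) cochain" where
  "covec_cochain \<phi> = (\<Sum>i\<in>UNIV. \<phi> $ i *s axis ({i}, {}) 1)"

definition vec_cochain :: "'k ^ 'i \<Rightarrow> ('k::field, 'i::finite) cochain" where
  "vec_cochain v = (\<Sum>i\<in>UNIV. v $ i *s axis ({}, {i}) 1)"

locale super_bracket =
  fixes B :: "('k::field, 'i::{finite,linorder}) cochain \<Rightarrow> ('k, 'i) cochain \<Rightarrow> ('k, 'i) cochain"
  assumes add_left: "B (a + b) c = B a c + B b c"
    and add_right: "B a (b + c) = B a b + B a c"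
    and scale_left: "B (k *s a) b = k *s B a b"
    and scale_right: "B a (k *s b) = k *s B a b"
    and bidegree: "a \<in> cochains p\<^sub>1 q\<^sub>1 \<Longrightarrow> b \<in> cochains p\<^sub>2 q\<^sub>2 \<Longrightarrow>
      B a b \<in> cochains (p\<^sub>1 + p\<^sub>2 - 1) (q\<^sub>1 + q\<^sub>2 - 1)"
    and vector_vector: "B (vec_cochain v) (vec_cochain w) = 0"
    and covector_covector: "B (covec_cochain \<phi>) (covec_cochain \<psi>) = 0"
    and covector_vector: "B (covec_cochain \<phi>) (vec_cochain v) = axis ({}, {}) (\<Sum>i\<in>UNIV. \<phi> $ i * v $ i)"
    and vector_covector: "B (vec_cochain v) (covec_cochain \<phi>) = axis ({}, {}) (\<Sum>i\<in>UNIV. \<phi> $ i * v $ i)"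
    and skew: "a \<in> cochains p\<^sub>1 q\<^sub>1 \<Longrightarrow> b \<in> cochains p\<^sub>2 q\<^sub>2 \<Longrightarrow>
      B a b = - ((-1) powi ((p\<^sub>1 + q\<^sub>1) * (p\<^sub>2 + q\<^sub>2)) *s B b a)"
    and leibniz: "a \<in> cochains p\<^sub>1 q\<^sub>1 \<Longrightarrow> b \<in> cochains p\<^sub>2 q\<^sub>2 \<Longrightarrow>
      B (a \<or>\<^sub>C b) c = a \<or>\<^sub>C B b c + (-1) powi ((p\<^sub>1 + q\<^sub>1) * (p\<^sub>2 + q\<^sub>2)) *s (b \<or>\<^sub>C B a c)"

text \<open>Existence and uniqueness are proved below, in \<open>super_bracket_unique_existence\<close>.\<close>

definition poisson ::
  "('k::field, 'i::{finite,linorder}) cochain \<Rightarrow> ('k, 'i) cochain \<Rightarrow> ('k, 'i) cochain" where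
  "poisson = (THE B. super_bracket B)"


section \<open>Cohomology with coefficients in the exterior powers of the adjoint module\<close>

text \<open>
  A Lie bracket on \<open>h\<close> is regarded as \<open>\<mu> = (\<Sum>i<j. e\<^sup>i \<and> e\<^sup>j \<otimes> [e\<^sub>i, e\<^sub>j])\<close>, where \<open>\<phi> \<and> \<psi>\<close> stands for the
  alternating form \<open>(u, v) \<mapsto> \<phi>(u) \<psi>(v) - \<phi>(v) \<psi>(u)\<close>.
\<close>

definition bracket_cochain ::
  "(('k, 'i) vec \<Rightarrow> ('k, 'i) vec \<Rightarrow> ('k, 'i) vec) \<Rightarrow> ('k::field, 'i::{finite,linorder}) cochain" where
  "bracket_cochain br = (\<Sum>i\<in>UNIV. \<Sum>j\<in>{i<..}.
     covec_cochain (axis i 1) \<or>\<^sub>C covec_cochain (axis j 1) \<or>\<^sub>C vec_cochain (br (axis i 1) (axis j 1)))"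

text \<open>
  With these conventions \<open>{\<mu>, -}\<close> is the negative of the differential normalised by
  \<open>(d v)(y) = [y, v]\<close>; cocycles and coboundaries are the same.
\<close>

definition ce_diff ::
  "(('k, 'i) vec \<Rightarrow> ('k, 'i) vec \<Rightarrow> ('k, 'i) vec) \<Rightarrow> ('k::field, 'i::{finite,linorder}) cochain \<Rightarrow> ('k, 'i) cochain" where
  "ce_diff br = poisson (bracket_cochain br)"

definition cocycles ::
  "(('k, 'i) vec \<Rightarrow> ('k, 'i) vec \<Rightarrow> ('k, 'i) vec) \<Rightarrow> int \<Rightarrow> int \<Rightarrow> ('k::field, 'i::{finite,linorder}) cochain set" where
  "cocycles br p q = {c \<in> cochains p q. ce_diff br c = 0}"

definition coboundaries ::
  "(('k, 'i) vec \<Rightarrow> ('k, 'i) vec \<Rightarrow> ('k, 'i) vec) \<Rightarrow> int \<Rightarrow> int \<Rightarrow> ('k::field, 'i::{finite,linorder}) cochain set" where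
  "coboundaries br p q = ce_diff br ` cochains (p - 1) q"

definition cohomology ::
  "(('k, 'i) vec \<Rightarrow> ('k, 'i) vec \<Rightarrow> ('k, 'i) vec) \<Rightarrow> int \<Rightarrow> int \<Rightarrow> ('k::field, 'i::{finite,linorder}) cochain set set" where
  "cohomology br p q = {z +o coboundaries br p q | z. z \<in> cocycles br p q}"

definition even_bidegrees :: "nat \<Rightarrow> (int \<times> int) set" where
  "even_bidegrees n = {(p, q). p \<in> {0..int n} \<and> q \<in> {0..int n} \<and> even (p + q)}"


section \<open>Lie algebras with explicit carrier\<close>

record ('k, 'a) lie_struct =
  lcarrier :: "'a set"
  lzero :: 'a
  ladd :: "'a \<Rightarrow> 'a \<Rightarrow> 'a"
  lscale :: "'k \<Rightarrow> 'a \<Rightarrow> 'a"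
  lbracket :: "'a \<Rightarrow> 'a \<Rightarrow> 'a"

locale lie_algebra =
  fixes L :: "('k::field, 'a) lie_struct"
  assumes zero_closed: "lzero L \<in> lcarrier L"
    and add_closed: "x \<in> lcarrier L \<Longrightarrow> y \<in> lcarrier L \<Longrightarrow> ladd L x y \<in> lcarrier L"
    and scale_closed: "x \<in> lcarrier L \<Longrightarrow> lscale L c x \<in> lcarrier L"
    and bracket_closed: "x \<in> lcarrier L \<Longrightarrow> y \<in> lcarrier L \<Longrightarrow> lbracket L x y \<in> lcarrier L"
    and add_assoc: "x \<in> lcarrier L \<Longrightarrow> y \<in> lcarrier L \<Longrightarrow> z \<in> lcarrier L \<Longrightarrow>
      ladd L (ladd L x y) z = ladd L x (ladd L y z)"
    and add_commute: "x \<in> lcarrier L \<Longrightarrow> y \<in> lcarrier L \<Longrightarrow> ladd L x y = ladd L y x"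
    and add_zero: "x \<in> lcarrier L \<Longrightarrow> ladd L x (lzero L) = x"
    and add_neg: "x \<in> lcarrier L \<Longrightarrow> ladd L x (lscale L (-1) x) = lzero L"
    and scale_add: "x \<in> lcarrier L \<Longrightarrow> y \<in> lcarrier L \<Longrightarrow>
      lscale L c (ladd L x y) = ladd L (lscale L c x) (lscale L c y)"
    and add_scale: "x \<in> lcarrier L \<Longrightarrow> lscale L (c + d) x = ladd L (lscale L c x) (lscale L d x)"
    and scale_scale: "x \<in> lcarrier L \<Longrightarrow> lscale L (c * d) x = lscale L c (lscale L d x)"
    and scale_one: "x \<in> lcarrier L \<Longrightarrow> lscale L 1 x = x"
    and bracket_add_left: "x \<in> lcarrier L \<Longrightarrow> y \<in> lcarrier L \<Longrightarrow> z \<in> lcarrier L \<Longrightarrow>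
      lbracket L (ladd L x y) z = ladd L (lbracket L x z) (lbracket L y z)"
    and bracket_add_right: "x \<in> lcarrier L \<Longrightarrow> y \<in> lcarrier L \<Longrightarrow> z \<in> lcarrier L \<Longrightarrow>
      lbracket L x (ladd L y z) = ladd L (lbracket L x y) (lbracket L x z)"
    and bracket_scale_left: "x \<in> lcarrier L \<Longrightarrow> y \<in> lcarrier L \<Longrightarrow>
      lbracket L (lscale L c x) y = lscale L c (lbracket L x y)"
    and bracket_scale_right: "x \<in> lcarrier L \<Longrightarrow> y \<in> lcarrier L \<Longrightarrow>
      lbracket L x (lscale L c y) = lscale L c (lbracket L x y)"
    and bracket_self: "x \<in> lcarrier L \<Longrightarrow> lbracket L x x = lzero L"
    and jacobi: "x \<in> lcarrier L \<Longrightarrow> y \<in> lcarrier L \<Longrightarrow> z \<in> lcarrier L \<Longrightarrow>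
      ladd L (lbracket L x (lbracket L y z))
        (ladd L (lbracket L y (lbracket L z x)) (lbracket L z (lbracket L x y))) = lzero L"

definition lie_isomorphic ::
  "('k::field, 'a) lie_struct \<Rightarrow> ('k, 'b) lie_struct \<Rightarrow> bool" (infix \<open>\<simeq>\<^sub>L\<close> 50) where
  "L \<simeq>\<^sub>L M \<longleftrightarrow> lie_algebra L \<and> lie_algebra M \<and>
     (\<exists>f. bij_betw f (lcarrier L) (lcarrier M) \<and>
       (\<forall>x\<in>lcarrier L. \<forall>y\<in>lcarrier L. f (ladd L x y) = ladd M (f x) (f y)) \<and>
       (\<forall>c. \<forall>x\<in>lcarrier L. f (lscale L c x) = lscale M c (f x)) \<and>
       (\<forall>x\<in>lcarrier L. \<forall>y\<in>lcarrier L. f (lbracket L x y) = lbracket M (f x) (f y)))"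

text \<open>Semidirect product \<open>G \<ltimes> V\<close> for an action \<open>\<rho>\<close> of \<open>G\<close> on \<open>V\<close> by derivations.\<close>

definition semidirect ::
  "('k::field, 'a) lie_struct \<Rightarrow> ('a \<Rightarrow> 'b \<Rightarrow> 'b) \<Rightarrow> ('k, 'b) lie_struct \<Rightarrow> ('k, 'a \<times> 'b) lie_struct" where
  "semidirect G \<rho> V = \<lparr>
     lcarrier = lcarrier G \<times> lcarrier V,
     lzero = (lzero G, lzero V),
     ladd = (\<lambda>(x, u) (y, v). (ladd G x y, ladd V u v)),
     lscale = (\<lambda>c (x, u). (lscale G c x, lscale V c u)),
     lbracket = (\<lambda>(x, u) (y, v). (lbracket G x y,
       ladd V (lbracket V u v) (ladd V (\<rho> x v) (lscale V (-1) (\<rho> y u))))) \<rparr>"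

definition gl :: "('k::field, 'k ^ 'n ^ 'n) lie_struct" where
  "gl = \<lparr> lcarrier = UNIV, lzero = 0, ladd = (+), lscale = (\<lambda>c A. \<chi> i. c *s (A $ i)),
     lbracket = (\<lambda>A B. A ** B - B ** A) \<rparr>"

definition underlying_abelian :: "('k, 'a) lie_struct \<Rightarrow> ('k, 'a) lie_struct" where
  "underlying_abelian L = L \<lparr> lbracket := \<lambda>x y. lzero L \<rparr>"


section \<open>The even cohomology as a Lie algebra\<close>

text \<open>
  The direct sum of the \<open>H\<^sup>p(h, \<Lambda>\<^sup>q h)\<close>, \<open>p + q\<close> even, is formed internally: a family of classes
  \<open>X p q = z p q + B p q\<close> is identified with its sum \<open>(\<Sum>z p q) + (\<Sum>B p q)\<close>, a coset of the even
  coboundaries. No information is lost, see \<open>even_cohomology_direct_sum\<close> below. Operations on cosets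
  are performed elementwise and saturated by adding the even coboundaries, so no representatives are
  chosen.
\<close>

definition even_coboundaries ::
  "(('k, 'i) vec \<Rightarrow> ('k, 'i) vec \<Rightarrow> ('k, 'i) vec) \<Rightarrow> ('k::field, 'i::{finite,linorder}) cochain set" where
  "even_coboundaries br = (\<Sum>(p, q)\<in>even_bidegrees CARD('i). coboundaries br p q)"

definition even_cohomology ::
  "(('k, 'i) vec \<Rightarrow> ('k, 'i) vec \<Rightarrow> ('k, 'i) vec) \<Rightarrow> ('k::field, ('k, 'i::{finite,linorder}) cochain set) lie_struct" where
  "even_cohomology br = \<lparr>
     lcarrier = {(\<Sum>(p, q)\<in>even_bidegrees CARD('i). X p q) | X.
       \<forall>(p, q)\<in>even_bidegrees CARD('i). X p q \<in> cohomology br p q},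
     lzero = even_coboundaries br,
     ladd = (\<lambda>X Y. X + Y),
     lscale = (\<lambda>c X. (\<lambda>x. c *s x) ` X + even_coboundaries br),
     lbracket = (\<lambda>X Y. {poisson x y | x y. x \<in> X \<and> y \<in> Y} + even_coboundaries br) \<rparr>"


section \<open>The Heisenberg Lie algebra\<close>

text \<open>\<open>X\<^sub>m\<^sub>1\<close> stands for \<open>x\<^sub>-\<^sub>1\<close>.\<close>

datatype heis = X\<^sub>1 | X\<^sub>m\<^sub>1 | H\<^sub>0

instance heis :: finite
proof
  have "(UNIV :: heis set) = {X\<^sub>1, X\<^sub>m\<^sub>1, H\<^sub>0}"
    using heis.exhaust by blast
  then show "finite (UNIV :: heis set)"
    by (metis finite.emptyI finite.insertI)
qed

fun heis_index :: "heis \<Rightarrow> nat" where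
  "heis_index X\<^sub>1 = 0" | "heis_index X\<^sub>m\<^sub>1 = 1" | "heis_index H\<^sub>0 = 2"

instantiation heis :: linorder
begin

definition "x \<le> y \<longleftrightarrow> heis_index x \<le> heis_index y"
definition "x < y \<longleftrightarrow> heis_index x < heis_index y"

instance
proof
  fix x y :: heis
  show "x \<le> y \<Longrightarrow> y \<le> x \<Longrightarrow> x = y"
    by (cases x; cases y) (auto simp: less_eq_heis_def)
qed (auto simp: less_eq_heis_def less_heis_def)

end

definition heisenberg :: "'k::field ^ heis \<Rightarrow> 'k ^ heis \<Rightarrow> 'k ^ heis" where
  "heisenberg u v = axis H\<^sub>0 (u $ X\<^sub>1 * v $ X\<^sub>m\<^sub>1 - u $ X\<^sub>m\<^sub>1 * v $ X\<^sub>1)"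


section \<open>Existence and uniqueness of the super-bracket\<close>

lemma cochain_expand: "(\<Sum>s\<in>UNIV. a $ s *s axis s 1) = (a :: ('k::field, 'i::finite) cochain)"
  by (rule basis_expansion)

lemma cochain_induct [case_names axis add scale]:
  fixes a :: "('k::field, 'i::finite) cochain"
  assumes ax: "\<And>s. P (axis s 1)" and add: "\<And>a b. P a \<Longrightarrow> P b \<Longrightarrow> P (a + b)"
    and scale: "\<And>k a. P a \<Longrightarrow> P (k *s a)"
  shows "P a"
proof -
  have P0: "P 0"
    using scale[OF ax, of 0 undefined] by simp
  have "P (\<Sum>s\<in>S. a $ s *s axis s 1)" if "finite S" for S
    using that by (induction S rule: finite_induct) (auto simp: P0 intro!: add scale ax)
  from this[of UNIV] show ?thesis by (simp add: cochain_expand)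
qed

definition vsign :: "'i::{finite,linorder} set \<times> 'i set \<Rightarrow> 'i set \<times> 'i set \<Rightarrow> 'k::field" where
  "vsign s t = (-1) ^ (card (fst t) * card (snd s)) * ext_sign (fst s) (fst t) * ext_sign (snd s) (snd t)"

definition union2 :: "'i set \<times> 'i set \<Rightarrow> 'i set \<times> 'i set \<Rightarrow> 'i set \<times> 'i set" where
  "union2 s t = (fst s \<union> fst t, snd s \<union> snd t)"

lemma axis_sum: "(\<Sum>s\<in>UNIV. (axis t x $ s) *s f s) = x *s (f t :: ('k::field)^'n)"
  for f :: "'s::finite \<Rightarrow> _"
proof -
  have "(\<Sum>s\<in>UNIV. (axis t x $ s) *s f s) = (\<Sum>s\<in>UNIV. if s = t then x *s f s else 0)"
    by (intro sum.cong) (auto simp: axis_def)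
  also have "\<dots> = x *s f t" by (simp add: sum.delta)
  finally show ?thesis .
qed

lemma wedge_axis: "wedge (axis I 1) (axis J 1) = ext_sign I J *s axis (I \<union> J) 1"
proof -
  have "wedge (axis I 1) (axis J 1) = (\<Sum>I'\<in>UNIV. (axis I 1 $ I') *s
     (\<Sum>J'\<in>UNIV. (axis J 1 $ J') *s (ext_sign I' J' *s axis (I' \<union> J') 1)))"
    by (simp add: wedge_def vec.scale_sum_right mult.assoc)
  then show ?thesis by (simp only: axis_sum vec.scale_one)
qed

lemma tensor_axis: "tensor (x *s axis I 1) (y *s axis J 1) = (x * y) *s axis (I, J) 1"
  by (auto simp: tensor_def vec_eq_iff axis_def)

lemma vee_eq: "a \<or>\<^sub>C b = (\<Sum>s\<in>UNIV. \<Sum>t\<in>UNIV. (a $ s * b $ t * vsign s t) *s axis (union2 s t) 1)"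
  by (simp add: vee_def split_def wedge_axis tensor_axis vsign_def union2_def mult_ac)

lemma vee_axis: "axis s 1 \<or>\<^sub>C axis t 1 = vsign s t *s axis (union2 s t) 1"
proof -
  have "axis s 1 \<or>\<^sub>C axis t 1 = (\<Sum>s'\<in>UNIV. (axis s 1 $ s') *s
     (\<Sum>t'\<in>UNIV. (axis t 1 $ t') *s (vsign s' t' *s axis (union2 s' t') 1)))"
    by (simp add: vee_eq vec.scale_sum_right mult.assoc)
  then show ?thesis by (simp only: axis_sum vec.scale_one)
qed

lemma vee_linear [simp]:
  "(a + b) \<or>\<^sub>C c = a \<or>\<^sub>C c + b \<or>\<^sub>C c" "a \<or>\<^sub>C (b + c) = a \<or>\<^sub>C b + a \<or>\<^sub>C c"
  "(k *s a) \<or>\<^sub>C c = k *s (a \<or>\<^sub>C c)" "a \<or>\<^sub>C (k *s c) = k *s (a \<or>\<^sub>C c)"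
  by (simp_all add: vee_eq algebra_simps sum.distrib vec.scale_sum_right
      vec.scale_left_distrib)

lemma vee_0 [simp]: "0 \<or>\<^sub>C c = 0" "c \<or>\<^sub>C 0 = 0"
  using vee_linear(3)[of 0 0 c] vee_linear(4)[of c 0 0] by simp_all

lemma vee_minus [simp]: "(- a) \<or>\<^sub>C c = - (a \<or>\<^sub>C c)" "a \<or>\<^sub>C (- c) = - (a \<or>\<^sub>C c)"
  using vee_linear(3)[of "-1" a c] vee_linear(4)[of a "-1" c] by (simp_all add: vec.scale_minus_left)

lemma vee_sum: "(\<Sum>x\<in>S. f x) \<or>\<^sub>C c = (\<Sum>x\<in>S. f x \<or>\<^sub>C c)" "c \<or>\<^sub>C (\<Sum>x\<in>S. f x) = (\<Sum>x\<in>S. c \<or>\<^sub>C f x)"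
  by (induction S rule: infinite_finite_induct; simp)+

lemma card_inv_Un1:
  fixes I J K :: "'i::{finite,linorder} set"
  assumes "I \<inter> J = {}"
  shows "card {(i, j). i \<in> I \<union> J \<and> j \<in> K \<and> j < i} =
    card {(i, j). i \<in> I \<and> j \<in> K \<and> j < i} + card {(i, j). i \<in> J \<and> j \<in> K \<and> j < i}"
  by (subst card_Un_disjoint[symmetric])
     (use assms in \<open>auto intro!: arg_cong[where f = card]\<close>)

lemma card_inv_Un2:
  fixes I J K :: "'i::{finite,linorder} set"
  assumes "I \<inter> J = {}"
  shows "card {(i, j). i \<in> K \<and> j \<in> I \<union> J \<and> j < i} =
    card {(i, j). i \<in> K \<and> j \<in> I \<and> j < i} + card {(i, j). i \<in> K \<and> j \<in> J \<and> j < i}"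
  by (subst card_Un_disjoint[symmetric])
     (use assms in \<open>auto intro!: arg_cong[where f = card]\<close>)

lemma ext_sign_cocycle:
  fixes I J K :: "'i::{finite,linorder} set"
  shows "ext_sign I J * ext_sign (I \<union> J) K = (ext_sign J K * ext_sign I (J \<union> K) :: 'k::field)"
proof (cases "I \<inter> J = {} \<and> I \<inter> K = {} \<and> J \<inter> K = {}")
  case True
  then have "(I \<union> J) \<inter> K = {}" "I \<inter> (J \<union> K) = {}" by auto
  with True show ?thesis
    by (simp add: ext_sign_def card_inv_Un1 card_inv_Un2 power_add del: Un_iff)
next
  case False
  then show ?thesis by (auto simp: ext_sign_def)
qed

lemma ext_sign_nonzero: "ext_sign I J \<noteq> (0 :: 'k::field) \<longleftrightarrow> I \<inter> J = {}"
  by (simp add: ext_sign_def)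

lemma ext_sign_commute:
  fixes I J :: "'i::{finite,linorder} set"
  shows "ext_sign J I = ((-1) ^ (card I * card J) * ext_sign I J :: 'k::field)"
proof (cases "I \<inter> J = {}")
  case True
  let ?A = "{(i, j). i \<in> I \<and> j \<in> J \<and> j < i}" and ?B = "{(i, j). i \<in> J \<and> j \<in> I \<and> j < i}"
  have "card (I \<times> J) = card (?A \<union> prod.swap ` ?B)"
    by (intro arg_cong[where f = card]) (use True in \<open>force simp: image_iff not_less_iff_gr_or_eq\<close>)
  also have "\<dots> = card ?A + card (prod.swap ` ?B)"
    by (rule card_Un_disjoint) auto
  also have "card (prod.swap ` ?B) = card ?B"
    by (rule card_image) simp
  finally have *: "card I * card J = card ?A + card ?B" by (simp add: card_cartesian_product)
  have "(-1 :: 'k) ^ card ?B = (-1) ^ (card ?A + card ?B) * (-1) ^ card ?A"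
    by (auto simp: minus_one_power_iff)
  with True * show ?thesis by (simp add: ext_sign_def Int_commute)
qed (auto simp: ext_sign_def)

lemma vsign_cocycle:
  "vsign s t * vsign (union2 s t) u = (vsign t u * vsign s (union2 t u) :: 'k::field)"
proof (cases "fst s \<inter> fst t = {} \<and> snd s \<inter> snd t = {} \<and> fst t \<inter> fst u = {} \<and> snd t \<inter> snd u = {}")
  case True
  have "vsign s t * vsign (union2 s t) u =
    ((-1) ^ (card (fst t) * card (snd s)) * (-1) ^ (card (fst u) * card (snd s \<union> snd t)) :: 'k) *
    (ext_sign (fst s) (fst t) * ext_sign (fst s \<union> fst t) (fst u)) *
    (ext_sign (snd s) (snd t) * ext_sign (snd s \<union> snd t) (snd u))"
    by (simp add: vsign_def union2_def mult_ac)
  also have "(-1) ^ (card (fst t) * card (snd s)) * (-1) ^ (card (fst u) * card (snd s \<union> snd t)) =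
    ((-1) ^ (card (fst u) * card (snd t)) * (-1) ^ (card (fst t \<union> fst u) * card (snd s)) :: 'k)"
    using True by (simp add: card_Un_disjoint power_add[symmetric] algebra_simps)
  finally show ?thesis
    by (simp add: ext_sign_cocycle vsign_def union2_def mult_ac)
next
  case False
  then have d: "fst s \<inter> fst t \<noteq> {} \<or> snd s \<inter> snd t \<noteq> {} \<or> fst t \<inter> fst u \<noteq> {} \<or> snd t \<inter> snd u \<noteq> {}"
    by blast
  then have "vsign s t * vsign (union2 s t) u = (0 :: 'k)"
    by (auto simp: vsign_def union2_def ext_sign_def)
  moreover from d have "vsign t u * vsign s (union2 t u) = (0 :: 'k)"
    by (auto simp: vsign_def union2_def ext_sign_def)
  ultimately show ?thesis by (rule trans[OF _ sym])
qed

lemma vee_assoc: "(a \<or>\<^sub>C b) \<or>\<^sub>C c = a \<or>\<^sub>C (b \<or>\<^sub>C c)"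
proof (induction a rule: cochain_induct)
  case (axis s)
  show ?case
  proof (induction b rule: cochain_induct)
    case (axis t)
    show ?case
    proof (induction c rule: cochain_induct)
      case (axis u)
      have "union2 (union2 s t) u = union2 s (union2 t u)" by (simp add: union2_def Un_assoc)
      then show ?case by (simp add: vee_axis vsign_cocycle)
    qed simp_all
  qed simp_all
qed simp_all

lemma cochainsD: "a \<in> cochains p q \<Longrightarrow> a $ s \<noteq> 0 \<Longrightarrow> int (card (fst s)) = p \<and> int (card (snd s)) = q"
  by (cases s) (auto simp: cochains_def)

lemma cochains_subspace [simp, intro]:
  "0 \<in> cochains p q" "a \<in> cochains p q \<Longrightarrow> k *s a \<in> cochains p q"
  "a \<in> cochains p q \<Longrightarrow> b \<in> cochains p q \<Longrightarrow> a + b \<in> cochains p q"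
  "a \<in> cochains p q \<Longrightarrow> - a \<in> cochains p q"
  by (auto simp: cochains_def) (metis add.right_neutral)+

lemma cochains_sum: "(\<And>x. x \<in> S \<Longrightarrow> f x \<in> cochains p q) \<Longrightarrow> sum f S \<in> cochains p q"
  by (induction S rule: infinite_finite_induct) auto

lemma cochains_axis: "int (card I) = p \<Longrightarrow> int (card J) = q \<Longrightarrow> axis (I, J) 1 \<in> cochains p q"
  by (auto simp: cochains_def axis_def)

lemma vsign_zero: "fst s \<inter> fst t \<noteq> {} \<or> snd s \<inter> snd t \<noteq> {} \<Longrightarrow> vsign s t = 0"
  by (auto simp: vsign_def ext_sign_def)

lemma vee_bidegree:
  assumes "a \<in> cochains p\<^sub>1 q\<^sub>1" "b \<in> cochains p\<^sub>2 q\<^sub>2"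
  shows "a \<or>\<^sub>C b \<in> cochains (p\<^sub>1 + p\<^sub>2) (q\<^sub>1 + q\<^sub>2)"
  unfolding vee_eq
proof (intro cochains_sum)
  fix s t :: "'b set \<times> 'b set"
  show "(a $ s * b $ t * vsign s t) *s axis (union2 s t) 1 \<in> cochains (p\<^sub>1 + p\<^sub>2) (q\<^sub>1 + q\<^sub>2)"
  proof (cases "a $ s = 0 \<or> b $ t = 0 \<or> fst s \<inter> fst t \<noteq> {} \<or> snd s \<inter> snd t \<noteq> {}")
    case True
    then have "a $ s * b $ t * vsign s t = 0"
      by (elim disjE) (simp_all add: vsign_zero)
    then show ?thesis by auto
  next
    case False
    then show ?thesis
      using cochainsD[OF assms(1), of s] cochainsD[OF assms(2), of t]
      by (auto simp: union2_def card_Un_disjoint intro!: cochains_axis cochains_subspace(2))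
  qed
qed

lemma powi_parity: "(-1) powi n = (if even n then 1 else -1 :: 'k::field)"
  by (cases "even n") (auto elim!: evenE oddE simp: power_int_add power_int_mult)

lemma minus_scale [simp]: "(-1) *s a = - (a :: 'k::field ^ 'n)"
  by simp

lemma vsign_commute:
  "vsign t s = ((-1) ^ ((card (fst s) + card (snd s)) * (card (fst t) + card (snd t))) * vsign s t :: 'k::field)"
  by (simp add: vsign_def ext_sign_commute[of "fst s"] ext_sign_commute[of "snd s"])
     (auto simp: minus_one_power_iff)

lemma vee_commute:
  fixes a b :: "('k::field, 'i::{finite,linorder}) cochain"
  assumes "a \<in> cochains p\<^sub>1 q\<^sub>1" "b \<in> cochains p\<^sub>2 q\<^sub>2"
  shows "b \<or>\<^sub>C a = (-1) powi ((p\<^sub>1 + q\<^sub>1) * (p\<^sub>2 + q\<^sub>2)) *s (a \<or>\<^sub>C b)"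
proof -
  have "b \<or>\<^sub>C a = (\<Sum>s\<in>UNIV. \<Sum>t\<in>UNIV. (b $ t * a $ s * vsign t s) *s axis (union2 t s) 1)"
    unfolding vee_eq by (rule sum.swap)
  also have "\<dots> = (\<Sum>s\<in>UNIV. \<Sum>t\<in>UNIV. (-1) powi ((p\<^sub>1 + q\<^sub>1) * (p\<^sub>2 + q\<^sub>2)) *s
      ((a $ s * b $ t * vsign s t) *s axis (union2 s t) 1))"
  proof (intro sum.cong refl)
    fix s t :: "'i set \<times> 'i set"
    have j: "union2 t s = union2 s t" by (auto simp: union2_def)
    show "(b $ t * a $ s * vsign t s) *s axis (union2 t s) 1 = (-1) powi ((p\<^sub>1 + q\<^sub>1) * (p\<^sub>2 + q\<^sub>2)) *s
      ((a $ s * b $ t * vsign s t) *s axis (union2 s t) 1)"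
    proof (cases "a $ s = 0 \<or> b $ t = 0")
      case False
      then have "int (card (fst s)) = p\<^sub>1" "int (card (snd s)) = q\<^sub>1" "int (card (fst t)) = p\<^sub>2" "int (card (snd t)) = q\<^sub>2"
        using cochainsD[OF assms(1), of s] cochainsD[OF assms(2), of t] by auto
      then have "(-1 :: 'k) powi ((p\<^sub>1 + q\<^sub>1) * (p\<^sub>2 + q\<^sub>2)) =
        (-1) ^ ((card (fst s) + card (snd s)) * (card (fst t) + card (snd t)))"
        by (auto simp: powi_parity minus_one_power_iff)
      then show ?thesis by (simp add: j vsign_commute[of t s] mult_ac)
    qed auto
  qed
  finally show ?thesis by (simp only: vee_eq vec.scale_sum_right)
qed


text \<open>Generators, indexed by \<open>Inl i\<close> for \<open>e\<^sup>i\<close> and \<open>Inr i\<close> for \<open>e\<^sub>i\<close>.\<close>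

fun gen :: "'i + 'i \<Rightarrow> ('k::field, 'i::finite) cochain" where
  "gen (Inl i) = axis ({i}, {}) 1"
| "gen (Inr i) = axis ({}, {i}) 1"

fun gmem :: "'i + 'i \<Rightarrow> 'i set \<times> 'i set \<Rightarrow> bool" where
  "gmem (Inl i) s \<longleftrightarrow> i \<in> fst s"
| "gmem (Inr i) s \<longleftrightarrow> i \<in> snd s"

fun gins :: "'i + 'i \<Rightarrow> 'i set \<times> 'i set \<Rightarrow> 'i set \<times> 'i set" where
  "gins (Inl i) s = (insert i (fst s), snd s)"
| "gins (Inr i) s = (fst s, insert i (snd s))"

fun gdel :: "'i + 'i \<Rightarrow> 'i set \<times> 'i set \<Rightarrow> 'i set \<times> 'i set" where
  "gdel (Inl i) s = (fst s - {i}, snd s)"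
| "gdel (Inr i) s = (fst s, snd s - {i})"

fun gless :: "'i + 'i \<Rightarrow> 'i + 'i::linorder \<Rightarrow> bool" where
  "gless (Inl i) (Inl j) \<longleftrightarrow> i < j"
| "gless (Inl i) (Inr j) \<longleftrightarrow> True"
| "gless (Inr i) (Inl j) \<longleftrightarrow> False"
| "gless (Inr i) (Inr j) \<longleftrightarrow> i < j"

fun gpos :: "'i + 'i \<Rightarrow> 'i::{finite,linorder} set \<times> 'i set \<Rightarrow> nat" where
  "gpos (Inl i) s = card {j \<in> fst s. j < i}"
| "gpos (Inr i) s = card (fst s) + card {j \<in> snd s. j < i}"

fun gdual :: "'i + 'i \<Rightarrow> 'i + 'i" where
  "gdual (Inl i) = Inr i"
| "gdual (Inr i) = Inl i"

definition size2 :: "'i set \<times> 'i set \<Rightarrow> nat" where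
  "size2 s = card (fst s) + card (snd s)"

lemma gless_total: "g \<noteq> h \<Longrightarrow> gless g h \<longleftrightarrow> \<not> gless h g"
  by (cases g; cases h) auto

lemma gless_irrefl [simp]: "\<not> gless g g"
  by (cases g) auto

lemma card_below_insert:
  fixes I :: "'i::{finite,linorder} set"
  assumes "k \<notin> I"
  shows "card {j. (j = k \<or> j \<in> I) \<and> j < i} = card {j \<in> I. j < i} + (if k < i then 1 else 0)"
proof -
  have "{j. (j = k \<or> j \<in> I) \<and> j < i} = (if k < i then insert k {j \<in> I. j < i} else {j \<in> I. j < i})"
    by auto
  then show ?thesis using assms by simp
qed

lemma gpos_gins: "\<not> gmem h s \<Longrightarrow> gpos g (gins h s) = gpos g s + (if gless h g then 1 else 0)"
  by (cases g; cases h) (auto simp: card_below_insert)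

lemma g_simps [simp]:
  "gmem g (gins g s)" "\<not> gmem g (gdel g s)"
  "g \<noteq> h \<Longrightarrow> gmem g (gins h s) \<longleftrightarrow> gmem g s" "g \<noteq> h \<Longrightarrow> gmem g (gdel h s) \<longleftrightarrow> gmem g s"
  "\<not> gmem g s \<Longrightarrow> gdel g (gins g s) = s" "gmem g s \<Longrightarrow> gins g (gdel g s) = s"
  "g \<noteq> h \<Longrightarrow> gdel g (gins h s) = gins h (gdel g s)"
  "gdual (gdual g) = g" "gdual g = gdual h \<longleftrightarrow> g = h"
  by (cases g; cases h; cases s; auto)+

lemma size2_gins: "\<not> gmem g s \<Longrightarrow> size2 (gins g s :: 'i::finite set \<times> _) = Suc (size2 s)"
  by (cases g) (auto simp: size2_def)

lemma size2_gdel: "gmem g s \<Longrightarrow> size2 (s :: 'i::finite set \<times> _) = Suc (size2 (gdel g s))"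
  using size2_gins[of g "gdel g s"] by simp

lemma gpos_gdel: "gmem h s \<Longrightarrow> gpos g s = gpos g (gdel h s) + (if gless h g then 1 else 0)"
  using gpos_gins[of h "gdel h s" g] by simp

lemma ext_sign_empty [simp]: "ext_sign {} J = 1" "ext_sign I {} = 1"
  by (simp_all add: ext_sign_def)

lemma ext_sign_single: "ext_sign {i} J = (if i \<in> J then 0 else (-1) ^ card {j \<in> J. j < i})"
proof -
  have "{(a, j). a \<in> {i} \<and> j \<in> J \<and> j < a} = Pair i ` {j \<in> J. j < i}" by auto
  then have "card {(a, j). a \<in> {i} \<and> j \<in> J \<and> j < a} = card {j \<in> J. j < i}"
    by (simp add: card_image inj_on_def)
  then show ?thesis by (auto simp: ext_sign_def)
qed

lemma gen_vee_axis:
  "gen g \<or>\<^sub>C axis s 1 = (if gmem g s then 0 else (-1) ^ gpos g s *s axis (gins g s) 1)"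
  by (cases g) (auto simp: vee_axis vsign_def union2_def ext_sign_single power_add)

lemma axis_gins:
  assumes "\<not> gmem g s"
  shows "axis (gins g s) 1 = (-1) ^ gpos g s *s (gen g \<or>\<^sub>C axis s 1)"
  using assms by (simp add: gen_vee_axis power_add[symmetric] flip: mult_2)

lemma index_induct [case_names empty gins]:
  fixes s :: "'i::finite set \<times> 'i set"
  assumes "P ({}, {})" and "\<And>g s. \<not> gmem g s \<Longrightarrow> P s \<Longrightarrow> P (gins g s)"
  shows "P s"
proof (induction "size2 s" arbitrary: s)
  case 0
  then have "s = ({}, {})" by (cases s) (auto simp: size2_def)
  then show ?case using assms(1) by simp
next
  case (Suc n)
  have "\<exists>g. gmem g s"
  proof (rule ccontr)
    assume "\<nexists>g. gmem g s"
    then have "fst s = {}" "snd s = {}"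
      by (metis gmem.simps(1) all_not_in_conv, metis gmem.simps(2) all_not_in_conv)
    then show False using Suc.hyps(2) by (simp add: size2_def)
  qed
  then obtain g where g: "gmem g s" by blast
  then have "P (gdel g s)" using Suc.hyps size2_gdel[OF g] by simp
  then show ?case using assms(2)[of g "gdel g s"] g by simp
qed

abbreviation unit_cochain :: "('k::field, 'i::{finite,linorder}) cochain" where
  "unit_cochain \<equiv> axis ({}, {}) 1"

lemma one_vee [simp]: "unit_cochain \<or>\<^sub>C a = a"
  by (induction a rule: cochain_induct) (simp_all add: vee_axis vsign_def union2_def)

lemma vee_one [simp]: "a \<or>\<^sub>C unit_cochain = a"
  by (induction a rule: cochain_induct) (simp_all add: vee_axis vsign_def union2_def)

lemma cochain_word_induct [case_names one gen add scale]:
  fixes a :: "('k::field, 'i::{finite,linorder}) cochain"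
  assumes "P unit_cochain" and gen: "\<And>g a. P a \<Longrightarrow> P (gen g \<or>\<^sub>C a)"
    and add: "\<And>a b. P a \<Longrightarrow> P b \<Longrightarrow> P (a + b)" and scale: "\<And>k a. P a \<Longrightarrow> P (k *s a)"
  shows "P a"
proof (induction a rule: cochain_induct)
  case (axis s)
  show ?case
    by (induction s rule: index_induct) (auto simp: axis_gins intro: assms)
qed (auto intro: add scale)

definition dv :: "'i + 'i \<Rightarrow> ('k::field, 'i::{finite,linorder}) cochain \<Rightarrow> ('k, 'i) cochain" where
  "dv g a = (\<Sum>s\<in>UNIV. a $ s *s (if gmem g s then (-1) ^ gpos g s *s axis (gdel g s) 1 else 0))"

lemma dv_linear [simp]: "dv g (a + b) = dv g a + dv g b" "dv g (k *s a) = k *s dv g a"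
  by (simp_all add: dv_def vec.scale_left_distrib sum.distrib vec.scale_sum_right)

lemma dv_axis: "dv g (axis s 1) = (if gmem g s then (-1) ^ gpos g s *s axis (gdel g s) 1 else 0)"
  unfolding dv_def axis_sum by simp

lemma dv_minus [simp]: "dv g (- a) = - dv g a"
  using dv_linear(2)[of g "-1" a] by simp

lemma dv_0 [simp]: "dv g 0 = 0"
  using dv_linear(2)[of g 0 0] by simp

lemma dv_one [simp]: "dv g unit_cochain = 0"
  by (cases g) (simp_all add: dv_axis)

lemma dv_gen_vee: "dv g (gen h \<or>\<^sub>C a) = (if g = h then a else 0) - gen h \<or>\<^sub>C dv g a"
proof (induction a rule: cochain_induct)
  case (axis s)
  show ?case
  proof (cases "g = h")
    case True
    then show ?thesis
      by (auto simp: gen_vee_axis dv_axis gpos_gins gpos_gdel power_add[symmetric] simp flip: mult_2)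
  next
    case False
    then show ?thesis
      using gless_total[OF False] gpos_gdel[of g s h]
      by (auto simp: gen_vee_axis dv_axis gpos_gins power_add mult.commute vec.scale_minus_left)
  qed
qed (auto simp: vec.scale_right_diff_distrib)

definition grade_inv :: "('k::field, 'i::{finite,linorder}) cochain \<Rightarrow> ('k, 'i) cochain" where
  "grade_inv a = (\<chi> s. (-1) ^ size2 s * a $ s)"

lemma inv_linear [simp]: "grade_inv (a + b) = grade_inv a + grade_inv b" "grade_inv (k *s a) = k *s grade_inv a"
  by (simp_all add: grade_inv_def vec_eq_iff algebra_simps)

lemma inv_minus [simp]: "grade_inv (- a) = - grade_inv a" "grade_inv 0 = 0"
  by (simp_all add: grade_inv_def vec_eq_iff)

lemma inv_diff [simp]: "grade_inv (a - b) = grade_inv a - grade_inv b"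
  by (simp add: grade_inv_def vec_eq_iff algebra_simps)

lemma inv_axis: "grade_inv (axis s 1) = (-1) ^ size2 s *s axis s 1"
  by (auto simp: grade_inv_def vec_eq_iff axis_def)

lemma inv_inv [simp]: "grade_inv (grade_inv a) = a"
  by (simp add: grade_inv_def vec_eq_iff power_add[symmetric] flip: mult_2 mult.assoc)

lemma inv_gen_vee: "grade_inv (gen g \<or>\<^sub>C a) = - (gen g \<or>\<^sub>C grade_inv a)"
  by (induction a rule: cochain_induct)
     (auto simp: gen_vee_axis inv_axis size2_gins mult.commute)

lemma inv_vee: "grade_inv (a \<or>\<^sub>C b) = grade_inv a \<or>\<^sub>C grade_inv b"
  by (induction a rule: cochain_word_induct)
     (simp_all add: inv_gen_vee vee_assoc inv_axis[of "({}, {})"] size2_def)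

lemma inv_dv: "grade_inv (dv g a) = - dv g (grade_inv a)"
  by (induction a rule: cochain_induct) (auto simp: dv_axis inv_axis size2_gdel mult.commute)

lemma dv_vee: "dv g (a \<or>\<^sub>C b) = dv g a \<or>\<^sub>C b + grade_inv a \<or>\<^sub>C dv g b"
proof (induction a rule: cochain_word_induct)
  case one
  then show ?case by (simp add: inv_axis size2_def)
next
  case (gen h a)
  have "dv g ((gen h \<or>\<^sub>C a) \<or>\<^sub>C b) = (if g = h then a \<or>\<^sub>C b else 0) - gen h \<or>\<^sub>C dv g (a \<or>\<^sub>C b)"
    by (simp add: vee_assoc dv_gen_vee)
  also have "\<dots> = dv g (gen h \<or>\<^sub>C a) \<or>\<^sub>C b + grade_inv (gen h \<or>\<^sub>C a) \<or>\<^sub>C dv g b"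
    using vee_linear(1)[of _ "- (gen h \<or>\<^sub>C dv g a)" b]
    by (simp add: gen dv_gen_vee inv_gen_vee vee_assoc)
  finally show ?case .
qed simp_all


definition poisson_expr :: "('k::field, 'i::{finite,linorder}) cochain \<Rightarrow> ('k, 'i) cochain \<Rightarrow> ('k, 'i) cochain" where
  "poisson_expr a b = (\<Sum>g\<in>UNIV. grade_inv (dv g a) \<or>\<^sub>C dv (gdual g) b)"

lemma gdual_bij: "bij gdual"
  by (metis g_simps(8) involuntory_imp_bij)

declare gen.simps [simp del]

lemma covector_axis: "covec_cochain \<phi> = (\<Sum>i\<in>UNIV. \<phi> $ i *s gen (Inl i))"
  and vector_axis: "vec_cochain v = (\<Sum>i\<in>UNIV. v $ i *s gen (Inr i))"
  by (simp_all add: covec_cochain_def vec_cochain_def gen.simps)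

lemma dv_gen: "dv g (gen h) = (if g = h then unit_cochain else 0)"
  using dv_gen_vee[of g h unit_cochain] by simp

lemma inv_one: "grade_inv unit_cochain = unit_cochain"
  by (simp add: inv_axis size2_def)

lemma poisson_expr_gen: "poisson_expr (gen g) (gen h) = (if h = gdual g then unit_cochain else 0)"
proof -
  have "poisson_expr (gen g) (gen h) = (\<Sum>g'\<in>UNIV. if g' = g then (if h = gdual g then unit_cochain else 0) else 0)"
    unfolding poisson_expr_def by (intro sum.cong refl) (auto simp: dv_gen inv_one)
  then show ?thesis by simp
qed

lemma poisson_expr_linear:
  "poisson_expr (a + b) c = poisson_expr a c + poisson_expr b c"
  "poisson_expr a (b + c) = poisson_expr a b + poisson_expr a c"
  "poisson_expr (k *s a) c = k *s poisson_expr a c"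
  "poisson_expr a (k *s c) = k *s poisson_expr a c"
  by (simp_all add: poisson_expr_def sum.distrib vec.scale_sum_right)

lemma inv_homogeneous: "a \<in> cochains p q \<Longrightarrow> grade_inv a = (-1) powi (p + q) *s a"
proof (unfold vec_eq_iff, rule)
  fix s
  assume "a \<in> cochains p q"
  then show "grade_inv a $ s = ((-1) powi (p + q) *s a) $ s"
    using cochainsD[of a p q s]
    by (cases "a $ s = 0") (auto simp: grade_inv_def powi_parity minus_one_power_iff size2_def)
qed

lemma inv_bidegree: "a \<in> cochains p q \<Longrightarrow> grade_inv a \<in> cochains p q"
  using inv_homogeneous[of a p q] by auto

lemma cochains_cong: "a \<in> cochains p q \<Longrightarrow> p = p' \<Longrightarrow> q = q' \<Longrightarrow> a \<in> cochains p' q'"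
  by simp

fun gdeg :: "'i + 'i \<Rightarrow> int \<times> int" where
  "gdeg (Inl i) = (1, 0)"
| "gdeg (Inr i) = (0, 1)"

lemma gdeg_cases: "fst (gdeg g) + snd (gdeg g) = 1"
  "fst (gdeg g) + fst (gdeg (gdual g)) = 1" "snd (gdeg g) + snd (gdeg (gdual g)) = 1"
  by (cases g; simp)+

lemma card_remove_int: "i \<in> I \<Longrightarrow> int (card (I - {i})) = int (card I) - 1"
  for I :: "'i::finite set"
  using card.remove[of I i] by simp

lemma dv_bidegree:
  assumes "a \<in> cochains p q"
  shows "dv g a \<in> cochains (p - fst (gdeg g)) (q - snd (gdeg g))"
  unfolding dv_def
proof (intro cochains_sum)
  fix s :: "'b set \<times> 'b set"
  show "a $ s *s (if gmem g s then (-1) ^ gpos g s *s axis (gdel g s) 1 else 0)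
    \<in> cochains (p - fst (gdeg g)) (q - snd (gdeg g))"
  proof (cases "a $ s = 0 \<or> \<not> gmem g s")
    case False
    then have "(axis (gdel g s) 1 :: ('a, 'b) cochain) \<in> cochains (p - fst (gdeg g)) (q - snd (gdeg g))"
      using cochainsD[OF assms, of s]
      by (cases g; cases s) (auto intro!: cochains_axis simp: card_remove_int simp del: card_Diff_singleton card_Diff_insert)
    then show ?thesis by (simp add: cochains_subspace(2))
  qed auto
qed

lemma poisson_expr_bidegree:
  assumes "a \<in> cochains p\<^sub>1 q\<^sub>1" "b \<in> cochains p\<^sub>2 q\<^sub>2"
  shows "poisson_expr a b \<in> cochains (p\<^sub>1 + p\<^sub>2 - 1) (q\<^sub>1 + q\<^sub>2 - 1)"
  unfolding poisson_expr_def
proof (intro cochains_sum)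
  fix g :: "'b + 'b"
  have "grade_inv (dv g a) \<in> cochains (p\<^sub>1 - fst (gdeg g)) (q\<^sub>1 - snd (gdeg g))"
    by (intro inv_bidegree dv_bidegree assms)
  from vee_bidegree[OF this dv_bidegree[OF assms(2)]]
  show "grade_inv (dv g a) \<or>\<^sub>C dv (gdual g) b \<in> cochains (p\<^sub>1 + p\<^sub>2 - 1) (q\<^sub>1 + q\<^sub>2 - 1)"
    by (rule cochains_cong) (use gdeg_cases[of g] in simp_all)
qed

lemma poisson_expr_leibniz:
  fixes a b c :: "('k::field, 'i::{finite,linorder}) cochain"
  assumes "a \<in> cochains p\<^sub>1 q\<^sub>1" "b \<in> cochains p\<^sub>2 q\<^sub>2"
  shows "poisson_expr (a \<or>\<^sub>C b) c =
    a \<or>\<^sub>C poisson_expr b c + (-1) powi ((p\<^sub>1 + q\<^sub>1) * (p\<^sub>2 + q\<^sub>2)) *s (b \<or>\<^sub>C poisson_expr a c)"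
proof -
  let ?s = "(-1) powi ((p\<^sub>1 + q\<^sub>1) * (p\<^sub>2 + q\<^sub>2)) :: 'k"
  have "grade_inv (dv g (a \<or>\<^sub>C b)) \<or>\<^sub>C dv (gdual g) c =
     a \<or>\<^sub>C (grade_inv (dv g b) \<or>\<^sub>C dv (gdual g) c) + ?s *s (b \<or>\<^sub>C (grade_inv (dv g a) \<or>\<^sub>C dv (gdual g) c))" for g
  proof -
    have d: "grade_inv (dv g a) \<in> cochains (p\<^sub>1 - fst (gdeg g)) (q\<^sub>1 - snd (gdeg g))"
      by (intro inv_bidegree dv_bidegree assms)
    have "grade_inv (dv g a) \<or>\<^sub>C grade_inv b = (-1) powi (p\<^sub>2 + q\<^sub>2) *s (grade_inv (dv g a) \<or>\<^sub>C b)"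
      by (simp add: inv_homogeneous[OF assms(2)])
    also have "\<dots> = ?s *s (b \<or>\<^sub>C grade_inv (dv g a))"
      unfolding vee_commute[OF assms(2) d] vec.scale_scale
      using gdeg_cases(1)[of g] by (cases g) (auto simp: powi_parity)
    finally have *: "grade_inv (dv g a) \<or>\<^sub>C grade_inv b = ?s *s (b \<or>\<^sub>C grade_inv (dv g a))" .
    show ?thesis by (simp add: dv_vee inv_vee * add.commute flip: vee_assoc)
  qed
  then show ?thesis
    by (simp add: poisson_expr_def sum.distrib vec.scale_sum_right vee_sum)
qed

lemma poisson_expr_skew:
  fixes a b :: "('k::field, 'i::{finite,linorder}) cochain"
  assumes "a \<in> cochains p\<^sub>1 q\<^sub>1" "b \<in> cochains p\<^sub>2 q\<^sub>2"
  shows "poisson_expr a b = - ((-1) powi ((p\<^sub>1 + q\<^sub>1) * (p\<^sub>2 + q\<^sub>2)) *s poisson_expr b a)"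
proof -
  let ?s = "(-1) powi ((p\<^sub>1 + q\<^sub>1) * (p\<^sub>2 + q\<^sub>2)) :: 'k"
  have *: "grade_inv (dv g a) \<or>\<^sub>C dv (gdual g) b = - (?s *s (grade_inv (dv (gdual g) b) \<or>\<^sub>C dv g a))" for g
  proof -
    note da = dv_bidegree[OF assms(1), of g] and db = dv_bidegree[OF assms(2), of "gdual g"]
    have "dv g a \<or>\<^sub>C dv (gdual g) b = (-1) powi ((p\<^sub>2 + q\<^sub>2 - 1) * (p\<^sub>1 + q\<^sub>1 - 1)) *s (dv (gdual g) b \<or>\<^sub>C dv g a)"
      unfolding vee_commute[OF db da] by (cases g) (simp_all add: algebra_simps)
    then show ?thesis
      unfolding inv_homogeneous[OF da] inv_homogeneous[OF db]
      by (cases g) (auto simp: powi_parity)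
  qed
  have "poisson_expr a b = (\<Sum>g\<in>UNIV. - (?s *s (grade_inv (dv (gdual g) b) \<or>\<^sub>C dv (gdual (gdual g)) a)))"
    by (simp add: poisson_expr_def *)
  also have "\<dots> = (\<Sum>g\<in>UNIV. - (?s *s (grade_inv (dv g b) \<or>\<^sub>C dv (gdual g) a)))"
    by (rule sum.reindex_bij_betw[OF gdual_bij, of "\<lambda>g. - (?s *s (grade_inv (dv g b) \<or>\<^sub>C dv (gdual g) a))"])
  finally show ?thesis by (simp add: poisson_expr_def vec.scale_sum_right sum_negf)
qed

lemma linear_sum:
  fixes F :: "'k::field ^ 'm \<Rightarrow> 'k ^ 'n"
  assumes "\<And>a b. F (a + b) = F a + F b" "\<And>k a. F (k *s a) = k *s F a"
  shows "F (\<Sum>x\<in>S. c x *s f x) = (\<Sum>x\<in>S. c x *s F (f x))"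
proof -
  have "F 0 = 0" using assms(2)[of 0 0] by simp
  then show ?thesis
    by (induction S rule: infinite_finite_induct) (simp_all add: assms)
qed

lemma poisson_expr_sums:
  "poisson_expr (\<Sum>x\<in>S. c x *s f x) b = (\<Sum>x\<in>S. c x *s poisson_expr (f x) b)"
  "poisson_expr b (\<Sum>x\<in>S. c x *s f x) = (\<Sum>x\<in>S. c x *s poisson_expr b (f x))"
  by (rule linear_sum; simp add: poisson_expr_linear)+

lemma axis_scale_sum: "(\<Sum>i\<in>S. f i *s axis s 1) = (axis s (\<Sum>i\<in>S. f i) :: 'k::field ^ 'n)"
  by (auto simp: vec_eq_iff axis_def)

lemma poisson_expr_super_bracket: "super_bracket poisson_expr"
proof
  fix \<phi> \<psi> v w :: "('a, 'b) vec"
  show "poisson_expr (vec_cochain v) (vec_cochain w) = 0" "poisson_expr (covec_cochain \<phi>) (covec_cochain \<psi>) = 0"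
    by (simp_all add: covector_axis vector_axis poisson_expr_sums poisson_expr_gen)
  have i: "(\<Sum>i\<in>UNIV. a i *s (\<Sum>j\<in>UNIV. b j *s (if i = j then unit_cochain else 0))) = axis ({}, {}) (\<Sum>i\<in>UNIV. a i * b i)"
    for a b :: "'b \<Rightarrow> 'a"
    by (simp add: if_distrib[of "(*s) _"] sum.delta' axis_scale_sum cong: if_cong)
  show "poisson_expr (covec_cochain \<phi>) (vec_cochain v) = axis ({}, {}) (\<Sum>i\<in>UNIV. \<phi> $ i * v $ i)"
    using i[of "\<lambda>i. v $ i" "\<lambda>i. \<phi> $ i"]
    by (simp add: covector_axis vector_axis poisson_expr_sums poisson_expr_gen mult.commute)
  show "poisson_expr (vec_cochain v) (covec_cochain \<phi>) = axis ({}, {}) (\<Sum>i\<in>UNIV. \<phi> $ i * v $ i)"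
    using i[of "\<lambda>i. \<phi> $ i" "\<lambda>i. v $ i"]
    by (simp add: covector_axis vector_axis poisson_expr_sums poisson_expr_gen)
qed (fact poisson_expr_linear poisson_expr_bidegree poisson_expr_skew poisson_expr_leibniz)+

lemma gen_covector: "covec_cochain (axis i 1) = gen (Inl i)" and gen_vector: "vec_cochain (axis i 1) = gen (Inr i)"
  unfolding covector_axis vector_axis axis_sum by simp_all

lemma gen_bidegree: "gen g \<in> cochains (fst (gdeg g)) (snd (gdeg g))"
  by (cases g) (simp_all add: cochains_axis gen.simps)

lemma axis_bidegree: "axis s 1 \<in> cochains (int (card (fst s))) (int (card (snd s)))"
  by (cases s) (simp add: cochains_axis)

context super_bracket
begin

lemma on_gen: "B (gen g) (gen h) = (if h = gdual g then unit_cochain else 0)"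
proof -
  have delta: "(\<Sum>j\<in>UNIV. (axis i 1 :: ('k, 'i) vec) $ j * (axis k 1 :: ('k, 'i) vec) $ j) = (if i = k then 1 else 0)" for i k
    by (simp add: axis_def if_distrib[of "\<lambda>x. x * _"] cong: if_cong)
  show ?thesis
    using vector_vector[of "axis i 1" "axis k 1" for i k]
      covector_covector[of "axis i 1" "axis k 1" for i k]
      covector_vector[of "axis i 1" "axis k 1" for i k]
      vector_covector[of "axis i 1" "axis k 1" for i k]
    by (cases g; cases h) (auto simp: gen_covector gen_vector delta)
qed

lemma on_one: "B unit_cochain c = 0"
proof -
  have "unit_cochain \<in> cochains 0 0" by (simp add: cochains_axis)
  from leibniz[OF this this, of c] have "B unit_cochain c = B unit_cochain c + B unit_cochain c"
    by simp
  then show ?thesis by simp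
qed

end

lemma super_bracket_eqI:
  assumes "super_bracket B" "super_bracket B'"
    and "\<And>g. B (gen g) c = B' (gen g) c"
  shows "B a c = B' a c"
proof (induction a rule: cochain_induct)
  interpret B: super_bracket B by fact
  interpret B': super_bracket B' by fact
  {
    case (axis s)
    show ?case
    proof (induction s rule: index_induct)
      case empty
      then show ?case by (simp add: B.on_one B'.on_one)
    next
      case (gins g s)
      then show ?case
        by (simp add: axis_gins B.scale_left B'.scale_left assms(3)
            B.leibniz[OF gen_bidegree axis_bidegree] B'.leibniz[OF gen_bidegree axis_bidegree])
    qed
  next
    case (add a b)
    then show ?case by (simp add: B.add_left B'.add_left)
  next
    case (scale k a)
    then show ?case by (simp add: B.scale_left B'.scale_left)
  }
qed

lemma super_bracket_unique:
  assumes "super_bracket B" "super_bracket B'"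
  shows "B = B'"
proof (intro ext)
  interpret B: super_bracket B by fact
  interpret B': super_bracket B' by fact
  fix a c
  have gen: "B a (gen h) = B' a (gen h)" for a h
    by (rule super_bracket_eqI[OF assms]) (simp add: B.on_gen B'.on_gen)
  have "B (gen h) c = B' (gen h) c" for h
  proof (induction c rule: cochain_induct)
    case (axis s)
    show ?case
      by (simp only: B.skew[OF gen_bidegree axis_bidegree] B'.skew[OF gen_bidegree axis_bidegree] gen)
  qed (simp_all add: B.add_right B'.add_right B.scale_right B'.scale_right)
  then show "B a c = B' a c" by (rule super_bracket_eqI[OF assms])
qed

theorem super_bracket_unique_existence: "\<exists>!B. super_bracket B"
  using poisson_expr_super_bracket super_bracket_unique by blast

lemma poisson_super_bracket: "super_bracket poisson"
  unfolding poisson_def using super_bracket_unique_existence by (rule theI')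

lemma poisson_eq: "poisson = poisson_expr"
  by (rule super_bracket_unique[OF poisson_super_bracket poisson_expr_super_bracket])

lemma sum_pair: "(\<Sum>s\<in>UNIV. f s) = (\<Sum>I\<in>UNIV. \<Sum>J\<in>UNIV. f (I, J))"
  by (simp add: sum.cartesian_product)

lemma tensor_sum:
  "tensor (\<Sum>x\<in>S. f x) v = (\<Sum>x\<in>S. tensor (f x) v)"
  "tensor \<phi> (\<Sum>x\<in>S. f x) = (\<Sum>x\<in>S. tensor \<phi> (f x))"
  by (simp_all add: tensor_def vec_eq_iff sum_distrib_left sum_distrib_right)

lemma vee_tensor:
  fixes \<phi> \<psi> v w :: "('k::field, 'i::{finite,linorder}) ext"
  assumes "tensor \<phi> v \<in> cochains p\<^sub>1 q\<^sub>1" "tensor \<psi> w \<in> cochains p\<^sub>2 q\<^sub>2"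
  shows "tensor \<phi> v \<or>\<^sub>C tensor \<psi> w = (-1) powi (p\<^sub>2 * q\<^sub>1) *s tensor (wedge \<phi> \<psi>) (wedge v w)"
proof -
  let ?F = "\<lambda>I\<^sub>1 I\<^sub>2 J\<^sub>1 J\<^sub>2. ((\<phi> $ I\<^sub>1 * \<psi> $ I\<^sub>2 * ext_sign I\<^sub>1 I\<^sub>2) * (v $ J\<^sub>1 * w $ J\<^sub>2 * ext_sign J\<^sub>1 J\<^sub>2)) *s
    (axis (I\<^sub>1 \<union> I\<^sub>2, J\<^sub>1 \<union> J\<^sub>2) 1 :: ('k, 'i) cochain)"
  let ?s = "(-1) powi (p\<^sub>2 * q\<^sub>1) :: 'k"
  have "tensor \<phi> v \<or>\<^sub>C tensor \<psi> w =
    (\<Sum>s\<in>UNIV. \<Sum>t\<in>UNIV. ?s *s ?F (fst s) (fst t) (snd s) (snd t))"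
    unfolding vee_eq
  proof (intro sum.cong refl)
    fix s t :: "'i set \<times> 'i set"
    show "(tensor \<phi> v $ s * tensor \<psi> w $ t * vsign s t) *s axis (union2 s t) 1 =
      ?s *s ?F (fst s) (fst t) (snd s) (snd t)"
    proof (cases "tensor \<phi> v $ s = 0 \<or> tensor \<psi> w $ t = 0")
      case True
      then show ?thesis by (auto simp: tensor_def)
    next
      case False
      then have "?s = (-1) ^ (card (fst t) * card (snd s))"
        using cochainsD[OF assms(1), of s] cochainsD[OF assms(2), of t]
        by (auto simp: powi_parity minus_one_power_iff)
      then show ?thesis by (simp add: tensor_def vsign_def union2_def mult_ac)
    qed
  qed
  also have "\<dots> = ?s *s (\<Sum>I\<^sub>1\<in>UNIV. \<Sum>J\<^sub>1\<in>UNIV. \<Sum>I\<^sub>2\<in>UNIV. \<Sum>J\<^sub>2\<in>UNIV. ?F I\<^sub>1 I\<^sub>2 J\<^sub>1 J\<^sub>2)"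
    by (simp add: sum_pair vec.scale_sum_right)
  also have "(\<Sum>I\<^sub>1\<in>UNIV. \<Sum>J\<^sub>1\<in>UNIV. \<Sum>I\<^sub>2\<in>UNIV. \<Sum>J\<^sub>2\<in>UNIV. ?F I\<^sub>1 I\<^sub>2 J\<^sub>1 J\<^sub>2) =
    (\<Sum>I\<^sub>1\<in>UNIV. \<Sum>I\<^sub>2\<in>UNIV. \<Sum>J\<^sub>1\<in>UNIV. \<Sum>J\<^sub>2\<in>UNIV. ?F I\<^sub>1 I\<^sub>2 J\<^sub>1 J\<^sub>2)"
    by (intro sum.cong refl sum.swap)
  also have "\<dots> = tensor (wedge \<phi> \<psi>) (wedge v w)"
    unfolding wedge_def unfolding tensor_sum(1) unfolding tensor_sum(2) tensor_axis ..
  finally show ?thesis .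
qed


section \<open>The direct sum decomposition, and the Heisenberg bracket as a cochain\<close>

lemma bracket_cochain_bidegree: "bracket_cochain br \<in> cochains 2 1"
proof -
  have "covec_cochain (axis i 1) \<in> cochains 1 0" for i
    unfolding gen_covector using gen_bidegree[of "Inl i"] by simp
  from vee_bidegree[OF this this] have c: "covec_cochain (axis i 1) \<or>\<^sub>C covec_cochain (axis j 1) \<in> cochains 2 0" for i j
    by simp
  have v: "vec_cochain u \<in> cochains 0 1" for u
    unfolding vector_axis by (intro cochains_sum cochains_subspace(2)) (simp add: cochains_axis gen.simps)
  show ?thesis
    unfolding bracket_cochain_def using vee_bidegree[OF c v] by (auto intro!: cochains_sum)
qed

lemma ce_diff_bidegree: "c \<in> cochains p q \<Longrightarrow> ce_diff br c \<in> cochains (p + 1) q"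
  unfolding ce_diff_def
  using super_bracket.bidegree[OF poisson_super_bracket bracket_cochain_bidegree, of c p q br]
  by (simp add: add.commute)

lemma cohomology_cochains:
  assumes "X \<in> cohomology br p q"
  shows "X \<noteq> {}" "X \<subseteq> cochains p q"
proof -
  have "coboundaries br p q \<subseteq> cochains p q"
    using ce_diff_bidegree[of _ "p - 1" q br] by (auto simp: coboundaries_def)
  moreover have "ce_diff br 0 \<in> coboundaries br p q" by (auto simp: coboundaries_def)
  ultimately show "X \<noteq> {}" "X \<subseteq> cochains p q"
    using assms by (auto simp: cohomology_def elt_set_plus_def cocycles_def)
qed


definition bicomponent :: "int \<times> int \<Rightarrow> ('k::field, 'i::finite) cochain \<Rightarrow> ('k, 'i) cochain" where
  "bicomponent pq c = (\<chi> s. if (int (card (fst s)), int (card (snd s))) = pq then c $ s else 0)"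

lemma component_homogeneous:
  assumes "c \<in> cochains p q"
  shows "bicomponent pq c = (if pq = (p, q) then c else 0)"
proof (unfold vec_eq_iff, rule)
  fix s show "bicomponent pq c $ s = (if pq = (p, q) then c else 0) $ s"
    using cochainsD[OF assms, of s] by (cases "c $ s = 0") (auto simp: bicomponent_def)
qed

lemma component_sum: "bicomponent pq (\<Sum>x\<in>S. f x) = (\<Sum>x\<in>S. bicomponent pq (f x))"
  by (auto simp: bicomponent_def vec_eq_iff)

lemma finite_even_bidegrees: "finite (even_bidegrees n)"
  by (rule finite_subset[of _ "{0..int n} \<times> {0..int n}"]) (auto simp: even_bidegrees_def)

lemma component_sum_classes:
  assumes "finite E" and X: "\<And>pq. pq \<in> E \<Longrightarrow> X pq \<in> cohomology br (fst pq) (snd pq)" and "pq \<in> E"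
  shows "X pq = bicomponent pq ` (\<Sum>rs\<in>E. X rs)"
proof -
  have c: "bicomponent pq (\<Sum>rs\<in>E. x rs) = x pq" if x: "\<And>rs. rs \<in> E \<Longrightarrow> x rs \<in> X rs" for x
  proof -
    have "bicomponent pq (\<Sum>rs\<in>E. x rs) = (\<Sum>rs\<in>E. if pq = rs then x rs else 0)"
      unfolding component_sum
    proof (intro sum.cong refl)
      fix rs assume "rs \<in> E"
      then have "x rs \<in> cochains (fst rs) (snd rs)"
        using x cohomology_cochains(2)[OF X] by blast
      then show "bicomponent pq (x rs) = (if pq = rs then x rs else 0)"
        by (simp add: component_homogeneous)
    qed
    also have "\<dots> = x pq" using assms by (simp add: sum.delta)
    finally show ?thesis .
  qed
  have "\<forall>rs\<in>E. \<exists>y. y \<in> X rs" using cohomology_cochains(1)[OF X] by blast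
  then obtain y where y: "\<And>rs. rs \<in> E \<Longrightarrow> y rs \<in> X rs" by metis
  show ?thesis
  proof
    show "bicomponent pq ` (\<Sum>rs\<in>E. X rs) \<subseteq> X pq"
      using c \<open>pq \<in> E\<close> by (auto simp: set_sum_alt[OF \<open>finite E\<close>])
    show "X pq \<subseteq> bicomponent pq ` (\<Sum>rs\<in>E. X rs)"
    proof
      fix z assume z: "z \<in> X pq"
      then have "(y(pq := z)) rs \<in> X rs" if "rs \<in> E" for rs using y that by simp
      from c[OF this] have "z = bicomponent pq (\<Sum>rs\<in>E. (y(pq := z)) rs)" by simp
      moreover have "(\<Sum>rs\<in>E. (y(pq := z)) rs) \<in> (\<Sum>rs\<in>E. X rs)"
        unfolding set_sum_alt[OF \<open>finite E\<close>] using \<open>\<And>rs. rs \<in> E \<Longrightarrow> (y(pq := z)) rs \<in> X rs\<close> by blast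
      ultimately show "z \<in> bicomponent pq ` (\<Sum>rs\<in>E. X rs)" by blast
    qed
  qed
qed

theorem even_cohomology_direct_sum:
  fixes br :: "('k, 'i) vec \<Rightarrow> ('k, 'i) vec \<Rightarrow> ('k::field, 'i::{finite,linorder}) vec"
  defines "E \<equiv> even_bidegrees CARD('i)"
  shows "bij_betw (\<lambda>X. \<Sum>pq\<in>E. X pq) (\<Pi>\<^sub>E pq\<in>E. cohomology br (fst pq) (snd pq))
    (lcarrier (even_cohomology br))"
  unfolding bij_betw_def
proof
  have fin: "finite E" unfolding E_def by (rule finite_even_bidegrees)
  show "inj_on (\<lambda>X. \<Sum>pq\<in>E. X pq) (\<Pi>\<^sub>E pq\<in>E. cohomology br (fst pq) (snd pq))"
  proof (rule inj_onI)
    fix X Y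
    assume X: "X \<in> (\<Pi>\<^sub>E pq\<in>E. cohomology br (fst pq) (snd pq))"
      and Y: "Y \<in> (\<Pi>\<^sub>E pq\<in>E. cohomology br (fst pq) (snd pq))"
      and eq: "(\<Sum>pq\<in>E. X pq) = (\<Sum>pq\<in>E. Y pq)"
    show "X = Y"
    proof (rule PiE_ext[OF X Y])
      fix pq assume pq: "pq \<in> E"
      have "X pq = bicomponent pq ` (\<Sum>rs\<in>E. X rs)" "Y pq = bicomponent pq ` (\<Sum>rs\<in>E. Y rs)"
        using X Y by (auto intro!: component_sum_classes[OF fin] pq)
      then show "X pq = Y pq" using eq by simp
    qed
  qed
  show "(\<lambda>X. \<Sum>pq\<in>E. X pq) ` (\<Pi>\<^sub>E pq\<in>E. cohomology br (fst pq) (snd pq)) = lcarrier (even_cohomology br)"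
  proof
    show "(\<lambda>X. \<Sum>pq\<in>E. X pq) ` (\<Pi>\<^sub>E pq\<in>E. cohomology br (fst pq) (snd pq)) \<subseteq> lcarrier (even_cohomology br)"
    proof
      fix S assume "S \<in> (\<lambda>X. \<Sum>pq\<in>E. X pq) ` (\<Pi>\<^sub>E pq\<in>E. cohomology br (fst pq) (snd pq))"
      then obtain X where X: "X \<in> (\<Pi>\<^sub>E pq\<in>E. cohomology br (fst pq) (snd pq))" "S = (\<Sum>pq\<in>E. X pq)" by blast
      then have "S = (\<Sum>(p, q)\<in>E. X (p, q))" "\<forall>(p, q)\<in>E. X (p, q) \<in> cohomology br p q"
        by (auto simp: split_def)
      then show "S \<in> lcarrier (even_cohomology br)"
        unfolding even_cohomology_def E_def by (auto intro!: exI[of _ "\<lambda>p q. X (p, q)"])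
    qed
    show "lcarrier (even_cohomology br) \<subseteq> (\<lambda>X. \<Sum>pq\<in>E. X pq) ` (\<Pi>\<^sub>E pq\<in>E. cohomology br (fst pq) (snd pq))"
    proof
      fix S assume "S \<in> lcarrier (even_cohomology br)"
      then obtain X where X: "\<forall>(p, q)\<in>E. X p q \<in> cohomology br p q" "S = (\<Sum>(p, q)\<in>E. X p q)"
        by (auto simp: even_cohomology_def E_def)
      then have "restrict (\<lambda>(p, q). X p q) E \<in> (\<Pi>\<^sub>E pq\<in>E. cohomology br (fst pq) (snd pq))"
        by (auto simp: split_def)
      moreover have "S = (\<Sum>pq\<in>E. restrict (\<lambda>(p, q). X p q) E pq)"
        unfolding X(2) by (intro sum.cong) auto
      ultimately show "S \<in> (\<lambda>X. \<Sum>pq\<in>E. X pq) ` (\<Pi>\<^sub>E pq\<in>E. cohomology br (fst pq) (snd pq))"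
        by blast
    qed
  qed
qed


lemma bracket_cochain_heisenberg:
  "bracket_cochain heisenberg = (axis ({X\<^sub>1, X\<^sub>m\<^sub>1}, {H\<^sub>0}) 1 :: ('k::field, heis) cochain)"
proof -
  have U: "(UNIV :: heis set) = {X\<^sub>1, X\<^sub>m\<^sub>1, H\<^sub>0}"
    using heis.exhaust by blast
  have lt: "X\<^sub>1 < j \<longleftrightarrow> j = X\<^sub>m\<^sub>1 \<or> j = H\<^sub>0" "X\<^sub>m\<^sub>1 < j \<longleftrightarrow> j = H\<^sub>0" "\<not> H\<^sub>0 < j" for j
    by (cases j; simp add: less_heis_def)+
  have gt: "{X\<^sub>1<..} = {X\<^sub>m\<^sub>1, H\<^sub>0}" "{X\<^sub>m\<^sub>1<..} = {H\<^sub>0}" "{H\<^sub>0<..} = {}"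
    by (auto simp: lt)
  have h: "heisenberg (axis i 1) (axis j 1 :: 'k ^ heis) = axis H\<^sub>0 (if i = X\<^sub>1 \<and> j = X\<^sub>m\<^sub>1 then 1
      else if i = X\<^sub>m\<^sub>1 \<and> j = X\<^sub>1 then -1 else 0)" for i j
    by (cases i; cases j) (auto simp: heisenberg_def axis_def)
  have z: "vec_cochain (axis i 0) = (0 :: ('k, heis) cochain)" for i
    by (simp add: vec_cochain_def axis_def)
  have e: "{j. j = X\<^sub>m\<^sub>1 \<and> j < X\<^sub>1} = {}"
    by (auto simp: less_heis_def)
  show ?thesis
    unfolding bracket_cochain_def U
    by (simp add: gt h z gen_covector gen_vector vee_assoc)
       (simp add: gen.simps(2) gen_vee_axis e)
qed

end

theory Submission
  imports Defs
begin

text \<open>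
  Let \<open>a, b, c\<close> be the basis of \<open>h\<^sup>*\<close> dual to \<open>x = X\<^sub>1, y = X\<^sub>m\<^sub>1, h = H\<^sub>0\<close>. The cochains form the exterior
  algebra of the six-dimensional space \<open>V\<close> spanned by \<open>a, b, c, x, y, h\<close>, which carries the symmetric
  pairing \<open>{-, -}\<close>, and the Lie bracket of the Heisenberg algebra is the decomposable element
  \<open>\<mu> = a b h\<close>. Its three factors \<open>t\<^sub>1 = a, t\<^sub>2 = b, t\<^sub>3 = h\<close> span a Lagrangian subspace \<open>L\<close> of \<open>V\<close>, and
  \<open>t\<^sub>1\<^sup>* = x, t\<^sub>2\<^sup>* = y, t\<^sub>3\<^sup>* = c\<close> span a complement dual to \<open>L\<close>. So the cochains are
  \<open>\<Lambda> L \<otimes> \<Lambda> L\<^sup>*\<close>, and the general linear group of this new space \<open>L\<close>, which mixes vectors and covectors of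
  the Heisenberg algebra, is the source of \<open>gl(3)\<close>.

  For a matrix \<open>A\<close> let \<open>Q(A) = \<Sum> A\<^sub>i\<^sub>j t\<^sub>i t\<^sub>j\<^sup>*\<close> (below: \<open>quad\<close>). Then \<open>{Q(A), -}\<close> is the derivation extending
  the action of \<open>A\<close> on \<open>L\<close> and \<open>L\<^sup>*\<close>, hence \<open>{Q(A), Q(B)} = Q([A, B])\<close> (\<open>poisson_quad_quad\<close>). In particular
  \<open>\<epsilon> = Q(1)\<close> commutes with every \<open>Q(A)\<close>. The assignment
    \<open>(A, B) \<mapsto> tr A + Q(A - tr A / 3) + Q(B) \<epsilon> + tr B \<epsilon>\<^sup>3\<close>
  (below: \<open>cocycle_of\<close>) takes values in even cocycles and is a homomorphism from the semidirect product
  to cochains, before passing to cohomology (\<open>poisson_cocycle_of\<close>): by the Leibniz rule everything follows from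
  the bracket of the \<open>Q\<close>'s, except that
  \<open>{Q(B) \<epsilon>, Q(D) \<epsilon>} = Q([B, D]) \<epsilon>\<^sup>2\<close> has to vanish, which it does because \<open>Q(C) \<epsilon>\<^sup>2\<close> is a multiple of
  \<open>tr C\<close>.

  It remains to see that every even class has exactly one such representative. The differential
  \<open>\<Sum> (\<partial>\<mu>/\<partial>t\<^sub>i) \<partial>/\<partial>t\<^sub>i\<^sup>*\<close> maps \<open>\<Lambda>\<^sup>p L \<otimes> \<Lambda>\<^sup>q L\<^sup>*\<close> to \<open>\<Lambda>\<^sup>p\<^sup>+\<^sup>2 L \<otimes> \<Lambda>\<^sup>q\<^sup>-\<^sup>1 L\<^sup>*\<close>. On even cochains it is injective on
  \<open>\<Lambda>\<^sup>2 L\<^sup>*\<close> and \<open>L \<otimes> \<Lambda>\<^sup>3 L\<^sup>*\<close>, is the trace on \<open>L \<otimes> L\<^sup>*\<close>, and vanishes elsewhere; its image on odd cochains is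
  \<open>\<Lambda>\<^sup>2 L\<close>, all of \<open>\<Lambda>\<^sup>3 L \<otimes> L\<^sup>*\<close> and the line of \<open>\<epsilon>\<^sup>2\<close>. What survives is \<open>1\<close>, \<open>sl(3)\<close> inside
  \<open>L \<otimes> L\<^sup>*\<close>, the quotient of \<open>\<Lambda>\<^sup>2 L \<otimes> \<Lambda>\<^sup>2 L\<^sup>* = gl(3) \<epsilon>\<close> by \<open>\<epsilon>\<^sup>2\<close>, and the top degree. The linear maps
  \<open>gl_part\<close> and \<open>abelian_part\<close> read off \<open>A\<close> and \<open>B\<close> from a cochain and vanish on coboundaries, which gives
  uniqueness; existence is \<open>even_cocycle_exact\<close>.

  Bigradings disappear from these arguments because the even cohomology is the quotient of all even
  cocycles by the differentials of all odd cochains (\<open>even_coboundaries_eq\<close>,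
  \<open>even_cohomology_carrier\<close>). That it is a Lie algebra is then transported from the semidirect product.
\<close>

section \<open>The Poisson bracket on even and odd cochains\<close>

lemma inv_gen: "grade_inv (gen g) = - gen g"
  using inv_gen_vee[of g unit_cochain] by (simp add: inv_one)

lemma gen_anticommute: "gen h \<or>\<^sub>C gen g = - (gen g \<or>\<^sub>C gen h)"
  using vee_commute[OF gen_bidegree gen_bidegree, of h g] by (cases g; cases h; simp)

lemma vee_gen_right: "a \<or>\<^sub>C gen g = gen g \<or>\<^sub>C grade_inv a"
proof (induction a rule: cochain_word_induct)
  case (gen h a)
  have "(gen h \<or>\<^sub>C a) \<or>\<^sub>C gen g = (gen h \<or>\<^sub>C gen g) \<or>\<^sub>C grade_inv a"
    by (simp add: vee_assoc gen)
  then show ?case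
    unfolding gen_anticommute[of h g] by (simp add: vee_assoc inv_gen_vee)
qed (simp_all add: inv_one)

text \<open>
  The elements of interest below, such as \<open>t\<^sub>i t\<^sub>j\<^sup>*\<close>, are not homogeneous for the bidegree. The following
  rules therefore depend only on parity, expressed as an eigenvalue of \<open>grade_inv\<close>.
\<close>

lemma even_commute:
  assumes "grade_inv a = a"
  shows "a \<or>\<^sub>C b = b \<or>\<^sub>C a"
proof (induction b rule: cochain_word_induct)
  case (gen g b)
  have "a \<or>\<^sub>C (gen g \<or>\<^sub>C b) = (a \<or>\<^sub>C gen g) \<or>\<^sub>C b" by (simp add: vee_assoc)
  then show ?case unfolding vee_gen_right assms by (simp add: vee_assoc gen)
qed simp_all

lemma odd_commute:
  assumes "grade_inv a = - a"
  shows "a \<or>\<^sub>C b = grade_inv b \<or>\<^sub>C a"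
proof (induction b rule: cochain_word_induct)
  case (gen g b)
  have "a \<or>\<^sub>C (gen g \<or>\<^sub>C b) = (a \<or>\<^sub>C gen g) \<or>\<^sub>C b" by (simp add: vee_assoc)
  then show ?case unfolding vee_gen_right assms by (simp add: vee_assoc gen inv_gen_vee)
qed (simp_all add: inv_one)

lemma dv_sum: "dv g (\<Sum>x\<in>S. f x) = (\<Sum>x\<in>S. dv g (f x))"
  by (induction S rule: infinite_finite_induct) simp_all

lemma dv_diff: "dv g (a - b) = dv g a - dv g b"
  using dv_linear(1)[of g a "- b"] by simp

lemma dv_anticommute: "dv g (dv h a) = - dv h (dv g a)"
proof (induction a rule: cochain_word_induct)
  case (gen k a)
  show ?case by (auto simp: dv_gen_vee dv_diff gen)
qed simp_all

lemma inv_sum: "grade_inv (\<Sum>x\<in>S. f x) = (\<Sum>x\<in>S. grade_inv (f x))"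
  by (induction S rule: infinite_finite_induct) simp_all

lemma inv_poisson_expr: "grade_inv (poisson_expr a b) = poisson_expr (grade_inv a) (grade_inv b)"
  by (simp add: poisson_expr_def inv_sum inv_vee inv_dv)

lemma poisson_expr_leibniz_right:
  assumes "grade_inv a = a"
  shows "poisson_expr a (b \<or>\<^sub>C c) = poisson_expr a b \<or>\<^sub>C c + b \<or>\<^sub>C poisson_expr a c"
proof -
  have "grade_inv (dv g a) \<or>\<^sub>C grade_inv b = b \<or>\<^sub>C grade_inv (dv g a)" for g
    using odd_commute[of "grade_inv (dv g a)" "grade_inv b"] assms by (simp add: inv_dv)
  then show ?thesis
    by (simp add: poisson_expr_def dv_vee vee_sum sum.distrib flip: vee_assoc)
qed

lemma poisson_expr_skew_even:
  assumes "grade_inv a = a" "grade_inv b = b"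
  shows "poisson_expr a b = - poisson_expr b a"
proof -
  have "grade_inv (dv g a) \<or>\<^sub>C dv (gdual g) b = - (grade_inv (dv (gdual g) b) \<or>\<^sub>C dv (gdual (gdual g)) a)" for g
    using odd_commute[of "dv g a" "dv (gdual g) b"] assms by (simp add: inv_dv)
  then have "poisson_expr a b = (\<Sum>g\<in>UNIV. - (grade_inv (dv (gdual g) b) \<or>\<^sub>C dv (gdual (gdual g)) a))"
    by (simp add: poisson_expr_def)
  also have "\<dots> = (\<Sum>g\<in>UNIV. - (grade_inv (dv g b) \<or>\<^sub>C dv (gdual g) a))"
    by (rule sum.reindex_bij_betw[OF gdual_bij])
  finally show ?thesis by (simp add: poisson_expr_def sum_negf)
qed

lemma vee_diff: "(a - b) \<or>\<^sub>C c = a \<or>\<^sub>C c - b \<or>\<^sub>C c" "c \<or>\<^sub>C (a - b) = c \<or>\<^sub>C a - c \<or>\<^sub>C b"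
  using vee_linear(1)[of a "- b" c] vee_linear(2)[of c a "- b"] by simp_all

text \<open>
  The Jacobi identity in the case of two odd arguments and an arbitrary third one: it makes \<open>{m, -}\<close> an
  odd derivation of the bracket, so that brackets of coboundaries with cocycles are coboundaries.
  Since \<open>{m, -}\<close> is \<open>\<Sum> (\<partial>\<^sub>g m) \<partial>\<^sub>g\<^sub>'\<close>, with \<open>g'\<close> dual to \<open>g\<close>, it anticommutes with the
  partial derivatives up to terms containing second derivatives of \<open>m\<close>. The second derivatives are contracted with one
  derivative of \<open>w\<close> and one of \<open>z\<close>, and they cancel between \<open>{{m, w}, z}\<close> and \<open>{w, {m, z}}\<close>.
\<close>

lemma poisson_expr_derivation:
  assumes m: "grade_inv m = - m" and w: "grade_inv w = - w"
  shows "poisson_expr m (poisson_expr w z) = poisson_expr (poisson_expr m w) z - poisson_expr w (poisson_expr m z)"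
proof -
  let ?D = "poisson_expr m"
  have ev: "grade_inv (dv g m) = dv g m" "grade_inv (dv g w) = dv g w" for g
    using m w by (simp_all add: inv_dv)
  have D: "?D f = (\<Sum>g\<in>UNIV. dv g m \<or>\<^sub>C dv (gdual g) f)" for f
    by (simp add: poisson_expr_def ev)
  have Dvee: "?D (a \<or>\<^sub>C b) = ?D a \<or>\<^sub>C b + grade_inv a \<or>\<^sub>C ?D b" for a b
  proof -
    have "dv g m \<or>\<^sub>C (grade_inv a \<or>\<^sub>C x) = grade_inv a \<or>\<^sub>C (dv g m \<or>\<^sub>C x)" for g x
      using even_commute[OF ev(1), of g "grade_inv a"] by (simp flip: vee_assoc)
    then show ?thesis
      by (simp add: D dv_vee vee_sum sum.distrib vee_assoc)
  qed
  \<comment> \<open>the only source of second derivatives of \<open>m\<close>\<close>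
  have dvD: "dv h (?D f) = (\<Sum>g\<in>UNIV. dv h (dv g m) \<or>\<^sub>C dv (gdual g) f) - ?D (dv h f)" for h f
    by (simp add: D dv_sum dv_vee ev sum.distrib dv_anticommute[of h "gdual _" f] sum_subtractf)
  have Dw: "poisson_expr (?D w) z =
      (\<Sum>h\<in>UNIV. \<Sum>g\<in>UNIV. dv g (dv h m) \<or>\<^sub>C dv (gdual g) w \<or>\<^sub>C dv (gdual h) z)
      + (\<Sum>h\<in>UNIV. ?D (dv h w) \<or>\<^sub>C dv (gdual h) z)"
  proof -
    have i: "grade_inv (?D (dv h w)) = - ?D (dv h w)" for h
      using m ev(2)[of h] poisson_expr_linear(3)[of "-1" m "dv h w"] by (simp add: inv_poisson_expr)
    have j: "grade_inv (dv h (dv g m) \<or>\<^sub>C dv (gdual g) w) = dv g (dv h m) \<or>\<^sub>C dv (gdual g) w" for g h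
      by (simp add: inv_vee inv_dv m w dv_anticommute[of h g])
    show ?thesis
      unfolding poisson_expr_def[of "?D w"]
      by (simp add: dvD inv_sum i j vee_diff vee_sum sum.distrib)
  qed
  have wD: "poisson_expr w (?D z) =
      (\<Sum>h\<in>UNIV. \<Sum>g\<in>UNIV. dv g (dv h m) \<or>\<^sub>C dv (gdual g) w \<or>\<^sub>C dv (gdual h) z)
      - (\<Sum>h\<in>UNIV. dv h w \<or>\<^sub>C ?D (dv (gdual h) z))"
  proof -
    \<comment> \<open>relabelling the two summation indices turns the second derivatives into those of \<open>Dw\<close>\<close>
    let ?F = "\<lambda>h g. dv g (dv h m) \<or>\<^sub>C dv (gdual g) w \<or>\<^sub>C dv (gdual h) z"
    have "(\<Sum>h\<in>UNIV. \<Sum>g\<in>UNIV. dv h w \<or>\<^sub>C (dv (gdual h) (dv g m) \<or>\<^sub>C dv (gdual g) z)) =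
        (\<Sum>h\<in>UNIV. \<Sum>g\<in>UNIV. ?F g (gdual h))"
      using even_commute[OF ev(2)] by (simp flip: vee_assoc)
    also have "\<dots> = (\<Sum>h\<in>UNIV. \<Sum>g\<in>UNIV. ?F g h)"
      by (rule sum.reindex_bij_betw[OF gdual_bij])
    also have "\<dots> = (\<Sum>h\<in>UNIV. \<Sum>g\<in>UNIV. ?F h g)" by (rule sum.swap)
    finally show ?thesis
      unfolding poisson_expr_def[of w]
      by (simp add: dvD ev vee_diff vee_sum sum_subtractf)
  qed
  have "?D (poisson_expr w z) = (\<Sum>h\<in>UNIV. ?D (dv h w) \<or>\<^sub>C dv (gdual h) z) + (\<Sum>h\<in>UNIV. dv h w \<or>\<^sub>C ?D (dv (gdual h) z))"
    unfolding poisson_expr_def[of w] by (simp add: ev linear_sum[of ?D "\<lambda>_. 1", simplified] poisson_expr_linear Dvee sum.distrib)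
  then show ?thesis by (simp add: Dw wD)
qed

section \<open>The even cohomology as cocycles modulo coboundaries\<close>

lemma bicomponent_linear:
  "bicomponent pq (a + b) = bicomponent pq a + bicomponent pq b"
  "bicomponent pq (k *s a) = k *s bicomponent pq a"
  "bicomponent pq 0 = 0"
  by (auto simp: bicomponent_def vec_eq_iff)

lemma bicomponent_cochains: "bicomponent (p, q) c \<in> cochains p q"
  by (auto simp: bicomponent_def cochains_def)

lemma ce_diff_linear:
  "ce_diff br (a + b) = ce_diff br a + ce_diff br b" "ce_diff br (k *s a) = k *s ce_diff br a"
  by (simp_all add: ce_diff_def poisson_eq poisson_expr_linear)

lemma ce_diff_sum: "ce_diff br (\<Sum>x\<in>S. f x) = (\<Sum>x\<in>S. ce_diff br (f x))"
  using linear_sum[of "ce_diff br" "\<lambda>_. 1" f S] by (simp add: ce_diff_linear)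

lemma bicomponent_ce_diff: "bicomponent (p, q) (ce_diff br c) = ce_diff br (bicomponent (p - 1, q) c)"
proof (induction c rule: cochain_induct)
  case (axis s)
  have z: "ce_diff br 0 = 0" using ce_diff_linear(2)[of br 0 0] by simp
  have s: "(axis s 1 :: ('a, 'b) cochain) \<in> cochains (int (card (fst s))) (int (card (snd s)))"
    by (rule axis_bidegree)
  show ?case
    using component_homogeneous[OF s, of "(p - 1, q)"]
      component_homogeneous[OF ce_diff_bidegree[OF s], of "(p, q)" br]
    by (auto simp: z)
qed (simp_all add: bicomponent_linear ce_diff_linear)

text \<open>
  A nonzero coordinate of an even cochain sits in even total degree. This needs \<open>2 \<noteq> 0\<close>, without which
  \<open>grade_inv\<close> does not detect parity.
\<close>

lemma even_decomposition:
  fixes c :: "('k::field_char_0, 'i::{finite,linorder}) cochain"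
  assumes "grade_inv c = c"
  shows "(\<Sum>pq\<in>even_bidegrees CARD('i). bicomponent pq c) = c"
proof (unfold vec_eq_iff, rule)
  fix s :: "'i set \<times> 'i set"
  have "(\<Sum>pq\<in>even_bidegrees CARD('i). bicomponent pq c) $ s =
    (\<Sum>pq\<in>even_bidegrees CARD('i). if pq = (int (card (fst s)), int (card (snd s))) then c $ s else 0)"
    by (auto simp: bicomponent_def intro!: sum.cong)
  also have "\<dots> = c $ s"
  proof (cases "c $ s = 0")
    case False
    have "grade_inv c $ s = c $ s" using assms by simp
    with False have "even (card (fst s) + card (snd s))"
      by (auto simp: grade_inv_def size2_def minus_one_power_iff split: if_splits)
    then have "(int (card (fst s)), int (card (snd s))) \<in> even_bidegrees CARD('i)"
      by (auto simp: even_bidegrees_def card_mono)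
    then show ?thesis by (simp add: finite_even_bidegrees sum.delta)
  qed (auto intro!: sum.neutral)
  finally show "(\<Sum>pq\<in>even_bidegrees CARD('i). bicomponent pq c) $ s = c $ s" .
qed

lemma cochains_parity:
  assumes "c \<in> cochains p q"
  shows "even (p + q) \<Longrightarrow> grade_inv c = c" and "odd (p + q) \<Longrightarrow> grade_inv c = - c"
  by (simp_all add: inv_homogeneous[OF assms] powi_parity)

definition odd_cochains :: "('k::field, 'i::{finite,linorder}) cochain set" where
  "odd_cochains = {w. grade_inv w = - w}"

definition even_cocycles ::
  "(('k, 'i) vec \<Rightarrow> ('k, 'i) vec \<Rightarrow> ('k, 'i) vec) \<Rightarrow> ('k::field, 'i::{finite,linorder}) cochain set" where
  "even_cocycles br = {z. grade_inv z = z \<and> ce_diff br z = 0}"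

lemma bracket_cochain_odd: "grade_inv (bracket_cochain br) = - bracket_cochain br"
  by (rule cochains_parity[OF bracket_cochain_bidegree]) simp

lemma inv_ce_diff: "grade_inv (ce_diff br c) = - ce_diff br (grade_inv c)"
  using poisson_expr_linear(3)[of "-1" "bracket_cochain br" "grade_inv c"]
  by (simp add: ce_diff_def poisson_eq inv_poisson_expr bracket_cochain_odd)

text \<open>
  The differential shifts bidegrees by \<open>(1, 0)\<close>, so the even bidegree components of \<open>d w\<close> are the
  differentials of the components of \<open>w\<close>.
\<close>

lemma even_coboundaries_eq:
  fixes br :: "('k, 'i) vec \<Rightarrow> ('k, 'i) vec \<Rightarrow> ('k::field_char_0, 'i::{finite,linorder}) vec"
  shows "even_coboundaries br = ce_diff br ` odd_cochains"
proof
  let ?E = "even_bidegrees CARD('i)"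
  show "even_coboundaries br \<subseteq> ce_diff br ` odd_cochains"
  proof
    fix x assume "x \<in> even_coboundaries br"
    then obtain s where s: "x = (\<Sum>pq\<in>?E. s pq)" "\<And>pq. pq \<in> ?E \<Longrightarrow> s pq \<in> coboundaries br (fst pq) (snd pq)"
      by (auto simp: even_coboundaries_def split_def set_sum_alt[OF finite_even_bidegrees])
    then have "\<forall>pq\<in>?E. \<exists>w. w \<in> cochains (fst pq - 1) (snd pq) \<and> s pq = ce_diff br w"
      by (auto simp: coboundaries_def)
    then obtain w where w: "\<And>pq. pq \<in> ?E \<Longrightarrow> w pq \<in> cochains (fst pq - 1) (snd pq) \<and> s pq = ce_diff br (w pq)"
      by metis
    have "grade_inv (\<Sum>pq\<in>?E. w pq) = (\<Sum>pq\<in>?E. - w pq)"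
      unfolding inv_sum
    proof (intro sum.cong refl)
      fix pq assume "pq \<in> ?E"
      then show "grade_inv (w pq) = - w pq"
        using w cochains_parity(2)[of "w pq" "fst pq - 1" "snd pq"]
        by (auto simp: even_bidegrees_def)
    qed
    then have "(\<Sum>pq\<in>?E. w pq) \<in> odd_cochains" by (simp add: odd_cochains_def sum_negf)
    moreover have "x = ce_diff br (\<Sum>pq\<in>?E. w pq)" using s w by (simp add: ce_diff_sum)
    ultimately show "x \<in> ce_diff br ` odd_cochains" by blast
  qed
  show "ce_diff br ` odd_cochains \<subseteq> even_coboundaries br"
  proof clarify
    fix w :: "('k, 'i) cochain" assume "w \<in> odd_cochains"
    then have "grade_inv (ce_diff br w) = ce_diff br w"
      using ce_diff_linear(2)[of br "-1" w] by (simp add: odd_cochains_def inv_ce_diff)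
    then have "ce_diff br w = (\<Sum>pq\<in>?E. bicomponent pq (ce_diff br w))"
      by (simp add: even_decomposition)
    moreover have "bicomponent pq (ce_diff br w) \<in> (case pq of (p, q) \<Rightarrow> coboundaries br p q)" for pq
      by (cases pq) (simp add: bicomponent_ce_diff coboundaries_def bicomponent_cochains)
    ultimately show "ce_diff br w \<in> even_coboundaries br"
      by (auto simp: even_coboundaries_def set_sum_alt[OF finite_even_bidegrees])
  qed
qed

lemma sum_cosets: "(\<Sum>x\<in>S. f x +o B x) = (\<Sum>x\<in>S. f x) +o (\<Sum>x\<in>S. B x)"
  for f :: "'s \<Rightarrow> 'a::comm_monoid_add"
  by (induction S rule: infinite_finite_induct) (simp_all add: set_plus_rearrange set_zero_plus2)

lemma even_cohomology_carrier:
  fixes br :: "('k, 'i) vec \<Rightarrow> ('k, 'i) vec \<Rightarrow> ('k::field_char_0, 'i::{finite,linorder}) vec"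
  shows "lcarrier (even_cohomology br) = {z +o even_coboundaries br | z. z \<in> even_cocycles br}"
proof
  let ?E = "even_bidegrees CARD('i)"
  show "lcarrier (even_cohomology br) \<subseteq> {z +o even_coboundaries br | z. z \<in> even_cocycles br}"
  proof
    fix C assume "C \<in> lcarrier (even_cohomology br)"
    then obtain X where X: "C = (\<Sum>pq\<in>?E. X (fst pq) (snd pq))"
        "\<forall>pq\<in>?E. X (fst pq) (snd pq) \<in> cohomology br (fst pq) (snd pq)"
      by (auto simp: even_cohomology_def split_def)
    then obtain z where z: "\<And>pq. pq \<in> ?E \<Longrightarrow> z pq \<in> cocycles br (fst pq) (snd pq) \<and>
        X (fst pq) (snd pq) = z pq +o coboundaries br (fst pq) (snd pq)"
      unfolding cohomology_def mem_Collect_eq by metis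
    have "C = (\<Sum>pq\<in>?E. z pq +o coboundaries br (fst pq) (snd pq))"
      unfolding X(1) using z by (intro sum.cong) auto
    then have "C = (\<Sum>pq\<in>?E. z pq) +o even_coboundaries br"
      by (simp add: sum_cosets even_coboundaries_def split_def)
    moreover have "grade_inv (z pq) = z pq" if "pq \<in> ?E" for pq
      using z[OF that] that by (auto simp: cocycles_def even_bidegrees_def intro: cochains_parity)
    then have "(\<Sum>pq\<in>?E. z pq) \<in> even_cocycles br"
      using z by (simp add: even_cocycles_def inv_sum ce_diff_sum cocycles_def)
    ultimately show "C \<in> {z +o even_coboundaries br | z. z \<in> even_cocycles br}" by blast
  qed
  show "{z +o even_coboundaries br | z. z \<in> even_cocycles br} \<subseteq> lcarrier (even_cohomology br)"
  proof clarify
    fix z assume z: "z \<in> even_cocycles br"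
    let ?X = "\<lambda>p q. bicomponent (p, q) z +o coboundaries br p q"
    have "bicomponent (p, q) z \<in> cocycles br p q" for p q
      using z bicomponent_ce_diff[of "p + 1" q br z]
      by (simp add: cocycles_def even_cocycles_def bicomponent_cochains bicomponent_linear)
    then have "\<forall>(p, q)\<in>?E. ?X p q \<in> cohomology br p q"
      by (auto simp: cohomology_def)
    moreover have "z +o even_coboundaries br = (\<Sum>(p, q)\<in>?E. ?X p q)"
      using z by (simp add: sum_cosets even_coboundaries_def split_def even_decomposition even_cocycles_def)
    ultimately show "z +o even_coboundaries br \<in> lcarrier (even_cohomology br)"
      by (auto simp: even_cohomology_def intro!: exI[of _ ?X])
  qed
qed

lemma coboundaries_subspace:
  fixes br :: "('k, 'i) vec \<Rightarrow> ('k, 'i) vec \<Rightarrow> ('k::field_char_0, 'i::{finite,linorder}) vec"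
  shows "0 \<in> even_coboundaries br"
    and "x \<in> even_coboundaries br \<Longrightarrow> y \<in> even_coboundaries br \<Longrightarrow> x + y \<in> even_coboundaries br"
    and "x \<in> even_coboundaries br \<Longrightarrow> k *s x \<in> even_coboundaries br"
proof -
  have o: "(0 :: ('k, 'i) cochain) \<in> odd_cochains" "a \<in> odd_cochains \<Longrightarrow> b \<in> odd_cochains \<Longrightarrow> a + b \<in> odd_cochains"
    "a \<in> odd_cochains \<Longrightarrow> k *s a \<in> odd_cochains" for a b :: "('k, 'i) cochain" and k
    by (simp_all add: odd_cochains_def)
  have "ce_diff br 0 = 0" using ce_diff_linear(2)[of br 0 0] by simp
  then show "0 \<in> even_coboundaries br"
    using o(1) by (force simp: even_coboundaries_eq)
  show "x \<in> even_coboundaries br \<Longrightarrow> y \<in> even_coboundaries br \<Longrightarrow> x + y \<in> even_coboundaries br"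
    using o(2) by (auto simp: even_coboundaries_eq simp flip: ce_diff_linear)
  show "x \<in> even_coboundaries br \<Longrightarrow> k *s x \<in> even_coboundaries br"
    using o(3) by (auto simp: even_coboundaries_eq simp flip: ce_diff_linear)
qed

lemma poisson_coboundary_cocycle:
  fixes br :: "('k, 'i) vec \<Rightarrow> ('k, 'i) vec \<Rightarrow> ('k::field_char_0, 'i::{finite,linorder}) vec"
  assumes b: "b \<in> even_coboundaries br" and z: "z \<in> even_cocycles br"
  shows "poisson b z \<in> even_coboundaries br" "poisson z b \<in> even_coboundaries br"
proof -
  obtain w where w: "b = ce_diff br w" "grade_inv w = - w"
    using b by (auto simp: even_coboundaries_eq odd_cochains_def)
  have ev: "grade_inv b = b" "grade_inv z = z"
    using w z ce_diff_linear(2)[of br "-1" w] by (simp_all add: inv_ce_diff even_cocycles_def)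
  have "poisson b z = ce_diff br (poisson w z)"
    using poisson_expr_derivation[OF bracket_cochain_odd[of br] w(2), of z] z poisson_expr_linear(4)[of w 0 0]
    by (simp add: w(1) ce_diff_def poisson_eq even_cocycles_def)
  moreover have "poisson w z \<in> odd_cochains"
    using w z poisson_expr_linear(3)[of "-1" w z]
    by (simp add: odd_cochains_def inv_poisson_expr poisson_eq even_cocycles_def)
  ultimately show *: "poisson b z \<in> even_coboundaries br"
    unfolding even_coboundaries_eq by blast
  show "poisson z b \<in> even_coboundaries br"
    using coboundaries_subspace(3)[OF *, of "-1"] poisson_expr_skew_even[OF ev(2,1)]
    by (simp add: poisson_eq)
qed

lemma coset_eq_iff:
  fixes br :: "('k, 'i) vec \<Rightarrow> ('k, 'i) vec \<Rightarrow> ('k::field_char_0, 'i::{finite,linorder}) vec"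
  shows "x +o even_coboundaries br = y +o even_coboundaries br \<longleftrightarrow> x - y \<in> even_coboundaries br"
proof
  assume "x +o even_coboundaries br = y +o even_coboundaries br"
  moreover have "x \<in> x +o even_coboundaries br"
    using coboundaries_subspace(1)[of br] by (force simp: elt_set_plus_def)
  ultimately show "x - y \<in> even_coboundaries br" by (auto simp: elt_set_plus_def)
next
  have sub: "x +o even_coboundaries br \<subseteq> y +o even_coboundaries br" if "x - y \<in> even_coboundaries br" for x y
  proof
    fix u assume "u \<in> x +o even_coboundaries br"
    then obtain b where "u = x + b" "b \<in> even_coboundaries br" by (auto simp: elt_set_plus_def)
    then have "u = y + (x - y + b)" "x - y + b \<in> even_coboundaries br"
      using coboundaries_subspace(2)[OF that] by simp_all
    then show "u \<in> y +o even_coboundaries br" unfolding elt_set_plus_def by blast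
  qed
  assume xy: "x - y \<in> even_coboundaries br"
  then have "y - x \<in> even_coboundaries br"
    using coboundaries_subspace(3)[OF xy, of "-1"] by simp
  with sub xy show "x +o even_coboundaries br = y +o even_coboundaries br" by blast
qed

text \<open>
  The assumption says that \<open>d \<circ> d = 0\<close> on odd cochains, a form of the Jacobi identity for \<open>br\<close>. It
  makes the bracket of classes independent of both representatives at once: the error terms contain the
  bracket of two coboundaries, which is a coboundary only because one of them is a cocycle.
\<close>

lemma even_cohomology_operations:
  fixes br :: "('k, 'i) vec \<Rightarrow> ('k, 'i) vec \<Rightarrow> ('k::field_char_0, 'i::{finite,linorder}) vec"
  defines "B \<equiv> even_coboundaries br"
  assumes BZ: "B \<subseteq> even_cocycles br"
  shows "lzero (even_cohomology br) = 0 +o B"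
    and "ladd (even_cohomology br) (x +o B) (y +o B) = (x + y) +o B"
    and "lscale (even_cohomology br) k (x +o B) = (k *s x) +o B"
    and "x \<in> even_cocycles br \<Longrightarrow> y \<in> even_cocycles br \<Longrightarrow>
      lbracket (even_cohomology br) (x +o B) (y +o B) = poisson x y +o B"
proof -
  note sub = coboundaries_subspace[where br = br, folded B_def]
  have absorb: "X + B = u +o B" if u: "u \<in> X" and X: "X \<subseteq> u +o B" for X u
  proof
    show "u +o B \<subseteq> X + B" using u by (auto simp: elt_set_plus_def set_plus_def)
    show "X + B \<subseteq> u +o B"
    proof
      fix v assume "v \<in> X + B"
      then obtain x b where "v = x + b" "x \<in> X" "b \<in> B" by (auto simp: set_plus_def)
      moreover then obtain b' where "x = u + b'" "b' \<in> B" using X by (auto simp: elt_set_plus_def)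
      ultimately show "v \<in> u +o B" using sub(2) by (auto simp: elt_set_plus_def add.assoc)
    qed
  qed
  have BB: "B + B = B" using absorb[of 0 B] sub by (simp add: set_zero_plus)
  show "lzero (even_cohomology br) = 0 +o B" by (simp add: even_cohomology_def B_def set_zero_plus)
  show "ladd (even_cohomology br) (x +o B) (y +o B) = (x + y) +o B"
    by (simp add: even_cohomology_def set_plus_rearrange BB)
  have "(\<lambda>x. k *s x) ` (x +o B) + B = (k *s x) +o B"
  proof (rule absorb)
    show "k *s x \<in> (\<lambda>x. k *s x) ` (x +o B)"
      using sub by (force simp: elt_set_plus_def)
    show "(\<lambda>x. k *s x) ` (x +o B) \<subseteq> (k *s x) +o B"
      using sub by (auto simp: elt_set_plus_def vec.scale_right_distrib)
  qed
  then show "lscale (even_cohomology br) k (x +o B) = (k *s x) +o B"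
    by (simp add: even_cohomology_def B_def)
  assume x: "x \<in> even_cocycles br" and y: "y \<in> even_cocycles br"
  have "{poisson u v | u v. u \<in> x +o B \<and> v \<in> y +o B} + B = poisson x y +o B"
  proof (rule absorb)
    have "x \<in> x +o B" "y \<in> y +o B" using sub by (force simp: elt_set_plus_def)+
    then show "poisson x y \<in> {poisson u v | u v. u \<in> x +o B \<and> v \<in> y +o B}" by blast
    show "{poisson u v | u v. u \<in> x +o B \<and> v \<in> y +o B} \<subseteq> poisson x y +o B"
    proof clarify
      fix u v assume "u \<in> x +o B" "v \<in> y +o B"
      then obtain b c where uv: "u = x + b" "v = y + c" and bc: "b \<in> B" "c \<in> B"
        by (auto simp: elt_set_plus_def)
      from bc BZ have "c \<in> even_cocycles br" by blast
      then have "poisson b y + (poisson x c + poisson b c) \<in> B"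
        using poisson_coboundary_cocycle[of b br] poisson_coboundary_cocycle[of c br] x y bc
        by (auto simp: B_def intro!: coboundaries_subspace(2))
      moreover have "poisson u v = poisson x y + (poisson b y + (poisson x c + poisson b c))"
        by (simp add: uv poisson_eq poisson_expr_linear)
      ultimately show "poisson u v \<in> poisson x y +o B" by (auto simp: elt_set_plus_def)
    qed
  qed
  then show "lbracket (even_cohomology br) (x +o B) (y +o B) = poisson x y +o B"
    by (simp add: even_cohomology_def B_def)
qed

section \<open>Lie algebra isomorphisms and the semidirect product\<close>

text \<open>
  Scalar multiplication of matrices, which \<open>gl\<close> performs row by row. Naming it keeps the
  simplifier from expanding matrix identities into entries.
\<close>

definition mscale :: "'k::field \<Rightarrow> 'k ^ 'n ^ 'm \<Rightarrow> 'k ^ 'n ^ 'm" where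
  "mscale c A = (\<chi> i. c *s (A $ i))"

lemma mscale_simps:
  "mscale c (A + B) = mscale c A + mscale c B" "mscale c (A - B) = mscale c A - mscale c B"
  "mscale (c + d) A = mscale c A + mscale d A" "mscale (c * d) A = mscale c (mscale d A)"
  "mscale 1 A = A" "mscale (- 1) A = - A"
  by (simp_all add: mscale_def vec_eq_iff algebra_simps)

lemma matrix_mult_bilinear:
  fixes A B C :: "'k::field ^ 'n ^ 'n"
  shows "(A - B) ** C = A ** C - B ** C" "C ** (A - B) = C ** A - C ** B"
    "(A + B) ** C = A ** C + B ** C" "C ** (A + B) = C ** A + C ** B"
    "mscale k A ** C = mscale k (A ** C)" "C ** mscale k A = mscale k (C ** A)"
  by (simp_all add: mscale_def matrix_matrix_mult_def vec_eq_iff algebra_simps sum.distrib sum_subtractf sum_distrib_left)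

lemma semidirect_gl:
  "semidirect (gl :: ('k::field, 'k ^ 'n ^ 'n) lie_struct) (lbracket gl) (underlying_abelian gl) = \<lparr>
     lcarrier = UNIV, lzero = (0, 0), ladd = (\<lambda>(A, B) (C, D). (A + C, B + D)),
     lscale = (\<lambda>c (A, B). (mscale c A, mscale c B)),
     lbracket = (\<lambda>(A, B) (C, D). (A ** C - C ** A, (A ** D - D ** A) - (C ** B - B ** C))) \<rparr>"
  by (auto simp: semidirect_def gl_def underlying_abelian_def mscale_def fun_eq_iff vec_eq_iff)

lemma semidirect_gl_lie_algebra:
  "lie_algebra (semidirect (gl :: ('k::field, 'k ^ 'n ^ 'n) lie_struct) (lbracket gl) (underlying_abelian gl))"
  unfolding semidirect_gl
  by unfold_locales
     (auto simp: mscale_simps matrix_mult_bilinear matrix_mul_assoc algebra_simps)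

text \<open>
  A bijection that respects the operations carries the Lie algebra axioms over, so that they need only
  be known on one side. For the even cohomology this replaces a verification of the axioms on cosets.
\<close>

lemma lie_isomorphic_transport:
  fixes L :: "('k::field, 'a) lie_struct" and M :: "('k, 'b) lie_struct"
  assumes M: "lie_algebra M"
    and g: "bij_betw g (lcarrier M) (lcarrier L)"
    and zero: "lzero L = g (lzero M)"
    and add: "\<And>x y. x \<in> lcarrier M \<Longrightarrow> y \<in> lcarrier M \<Longrightarrow> ladd L (g x) (g y) = g (ladd M x y)"
    and scale: "\<And>c x. x \<in> lcarrier M \<Longrightarrow> lscale L c (g x) = g (lscale M c x)"
    and bracket: "\<And>x y. x \<in> lcarrier M \<Longrightarrow> y \<in> lcarrier M \<Longrightarrow> lbracket L (g x) (g y) = g (lbracket M x y)"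
  shows "L \<simeq>\<^sub>L M"
proof -
  interpret M: lie_algebra M by fact
  note closed = M.zero_closed M.add_closed M.scale_closed M.bracket_closed
  note hom = zero add scale bracket
  have img: "lcarrier L = g ` lcarrier M" using g by (simp add: bij_betw_def)
  have "lie_algebra L"
  proof
    fix x y z and c d :: 'k
    show "lzero L \<in> lcarrier L" by (simp add: img hom closed)
    assume "x \<in> lcarrier L"
    then obtain u where u: "u \<in> lcarrier M" "x = g u" by (auto simp: img)
    show "lscale L c x \<in> lcarrier L" using u by (simp add: img hom closed)
    show "ladd L x (lzero L) = x" using u by (simp add: hom closed M.add_zero)
    show "ladd L x (lscale L (-1) x) = lzero L" using u by (simp add: hom closed M.add_neg)
    show "lscale L (c + d) x = ladd L (lscale L c x) (lscale L d x)"
      using u by (simp add: hom closed M.add_scale)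
    show "lscale L (c * d) x = lscale L c (lscale L d x)"
      using u by (simp add: hom closed M.scale_scale)
    show "lscale L 1 x = x" using u by (simp add: hom closed M.scale_one)
    show "lbracket L x x = lzero L" using u by (simp add: hom closed M.bracket_self)
    assume "y \<in> lcarrier L"
    then obtain v where v: "v \<in> lcarrier M" "y = g v" by (auto simp: img)
    show "ladd L x y \<in> lcarrier L" "lbracket L x y \<in> lcarrier L"
      using u v by (simp_all add: img hom closed)
    show "ladd L x y = ladd L y x" using u v by (simp add: hom closed M.add_commute)
    show "lscale L c (ladd L x y) = ladd L (lscale L c x) (lscale L c y)"
      using u v by (simp add: hom closed M.scale_add)
    show "lbracket L (lscale L c x) y = lscale L c (lbracket L x y)"
      using u v by (simp add: hom closed M.bracket_scale_left)
    show "lbracket L x (lscale L c y) = lscale L c (lbracket L x y)"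
      using u v by (simp add: hom closed M.bracket_scale_right)
    assume "z \<in> lcarrier L"
    then obtain w where w: "w \<in> lcarrier M" "z = g w" by (auto simp: img)
    note uvw = u v w
    show "ladd L (ladd L x y) z = ladd L x (ladd L y z)"
      using uvw by (simp add: hom closed M.add_assoc)
    show "lbracket L (ladd L x y) z = ladd L (lbracket L x z) (lbracket L y z)"
      using uvw by (simp add: hom closed M.bracket_add_left)
    show "lbracket L x (ladd L y z) = ladd L (lbracket L x y) (lbracket L x z)"
      using uvw by (simp add: hom closed M.bracket_add_right)
    show "ladd L (lbracket L x (lbracket L y z)) (ladd L (lbracket L y (lbracket L z x)) (lbracket L z (lbracket L x y))) = lzero L"
      using uvw by (simp add: hom closed M.jacobi)
  qed
  let ?f = "inv_into (lcarrier M) g"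
  have f: "?f (g x) = x" if "x \<in> lcarrier M" for x
    using g that by (simp add: bij_betw_inv_into_left)
  have "bij_betw ?f (lcarrier L) (lcarrier M)" using g by (rule bij_betw_inv_into)
  moreover have "(\<forall>x\<in>lcarrier L. \<forall>y\<in>lcarrier L. ?f (ladd L x y) = ladd M (?f x) (?f y)) \<and>
       (\<forall>c. \<forall>x\<in>lcarrier L. ?f (lscale L c x) = lscale M c (?f x)) \<and>
       (\<forall>x\<in>lcarrier L. \<forall>y\<in>lcarrier L. ?f (lbracket L x y) = lbracket M (?f x) (?f y))"
    by (simp add: img hom closed f)
  ultimately show ?thesis
    unfolding lie_isomorphic_def using M \<open>lie_algebra L\<close> by blast
qed

section \<open>A Lagrangian subspace adapted to the Heisenberg bracket\<close>

text \<open>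
  The basis \<open>t\<^sub>1, t\<^sub>2, t\<^sub>3\<close> of the Lagrangian subspace \<open>L\<close>: the three factors of the Heisenberg bracket
  \<open>\<mu>\<close>. Indices of type \<^typ>\<open>3\<close> are integers modulo 3, which allows cyclic formulas.
\<close>

definition lagr :: "3 \<Rightarrow> heis + heis" where
  "lagr i = (if i = 1 then Inl X\<^sub>1 else if i = 2 then Inl X\<^sub>m\<^sub>1 else Inr H\<^sub>0)"

lemma three_cases: "i = 1 \<or> i = 2 \<or> i = (3::3)" using exhaust_3 by blast

text \<open>The values at 4 and 5 occur because the simplifier adds numerals of type \<^typ>\<open>3\<close> without reducing them.\<close>

lemma lagr_simps [simp]: "lagr 1 = Inl X\<^sub>1" "lagr 2 = Inl X\<^sub>m\<^sub>1" "lagr 3 = Inr H\<^sub>0"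
  "lagr 4 = Inl X\<^sub>1" "lagr 5 = Inl X\<^sub>m\<^sub>1"
  by (simp_all add: lagr_def)

lemma lagr_eq_iff: "lagr i = lagr j \<longleftrightarrow> i = j"
  using three_cases[of i] three_cases[of j] by auto

lemma lagr_isotropic: "gdual (lagr i) \<noteq> lagr j" "lagr i \<noteq> gdual (lagr j)"
  using three_cases[of i] three_cases[of j] by auto

definition quad :: "'k ^ 3 ^ 3 \<Rightarrow> ('k::field, heis) cochain" where
  "quad A = (\<Sum>i\<in>UNIV. \<Sum>j\<in>UNIV. A $ i $ j *s (gen (lagr i) \<or>\<^sub>C gen (gdual (lagr j))))"

lemma quad_vee: "quad A \<or>\<^sub>C c = (\<Sum>i\<in>UNIV. \<Sum>j\<in>UNIV. A $ i $ j *s (gen (lagr i) \<or>\<^sub>C (gen (gdual (lagr j)) \<or>\<^sub>C c)))"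
  by (simp add: quad_def vee_sum vee_assoc)

lemma inv_quad: "grade_inv (quad A) = quad A"
  by (simp add: quad_def inv_sum inv_gen_vee inv_gen)

lemma quad_linear:
  "quad (A + B) = quad A + quad B" "quad (A - B) = quad A - quad B" "quad (\<chi> i. k *s (A $ i)) = k *s quad A"
  by (simp_all add: quad_def vec.scale_left_distrib vec.scale_left_diff_distrib sum.distrib sum_subtractf vec.scale_sum_right)

text \<open>
  \<open>{Q(A), -}\<close> acts on \<open>L\<close> by \<open>A\<close> and on the dual basis by minus the transpose of \<open>A\<close>.
\<close>

lemma poisson_quad_gen:
  fixes A :: "'k::field ^ 3 ^ 3"
  shows
  "poisson_expr (quad A) (gen (lagr k)) = (\<Sum>i\<in>UNIV. A $ i $ k *s gen (lagr i))"
  "poisson_expr (quad A) (gen (gdual (lagr k))) = - (\<Sum>j\<in>UNIV. A $ k $ j *s gen (gdual (lagr j)))"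
proof -
  have L: "poisson_expr (gen g \<or>\<^sub>C gen h) f = gen g \<or>\<^sub>C poisson_expr (gen h) f - gen h \<or>\<^sub>C poisson_expr (gen g) f"
    for g h and f :: "('k, heis) cochain"
    using poisson_expr_leibniz[OF gen_bidegree gen_bidegree, of g h f] by (cases g; cases h; simp)
  have "poisson_expr (gen (lagr i) \<or>\<^sub>C gen (gdual (lagr j))) (gen (lagr k)) = (if j = k then gen (lagr i) else 0 :: ('k, heis) cochain)" for i j
    by (simp add: L poisson_expr_gen lagr_isotropic lagr_eq_iff eq_commute[of k])
  then show "poisson_expr (quad A) (gen (lagr k)) = (\<Sum>i\<in>UNIV. A $ i $ k *s gen (lagr i))"
    by (simp add: quad_def poisson_expr_sums linear_sum[of "\<lambda>x. poisson_expr x b" "\<lambda>_. 1" for b, simplified]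
        poisson_expr_linear if_distrib[of "(*s) _"] cong: if_cong)
  have "poisson_expr (gen (lagr i) \<or>\<^sub>C gen (gdual (lagr j))) (gen (gdual (lagr k))) = (if i = k then - gen (gdual (lagr j)) else 0 :: ('k, heis) cochain)" for i j
    by (simp add: L poisson_expr_gen lagr_isotropic lagr_eq_iff eq_commute[of k])
  then have "poisson_expr (quad A) (gen (gdual (lagr k))) =
      (\<Sum>i\<in>UNIV. \<Sum>j\<in>UNIV. A $ i $ j *s (if i = k then - gen (gdual (lagr j)) else 0))"
    by (simp add: quad_def poisson_expr_sums linear_sum[of "\<lambda>x. poisson_expr x b" "\<lambda>_. 1" for b, simplified]
        poisson_expr_linear)
  also have "\<dots> = (\<Sum>i\<in>UNIV. if i = k then - (\<Sum>j\<in>UNIV. A $ i $ j *s gen (gdual (lagr j))) else 0)"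
    by (intro sum.cong refl) (simp add: sum_negf)
  finally show "poisson_expr (quad A) (gen (gdual (lagr k))) = - (\<Sum>j\<in>UNIV. A $ k $ j *s gen (gdual (lagr j)))" by simp
qed

text \<open>
  Applying the derivation \<open>{Q(A), -}\<close> to the first factors of \<open>Q(B) = \<Sum> B\<^sub>k\<^sub>l t\<^sub>k t\<^sub>l\<^sup>*\<close> yields \<open>Q(A B)\<close>, and to
  the second factors \<open>- Q(B A)\<close>.
\<close>

lemma poisson_quad_quad: "poisson_expr (quad A) (quad B) = quad (A ** B - B ** A)"
proof -
  have "poisson_expr (quad A) (quad B) =
     (\<Sum>k\<in>UNIV. \<Sum>l\<in>UNIV. B $ k $ l *s (\<Sum>i\<in>UNIV. A $ i $ k *s (gen (lagr i) \<or>\<^sub>C gen (gdual (lagr l)))))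
    - (\<Sum>k\<in>UNIV. \<Sum>l\<in>UNIV. B $ k $ l *s (\<Sum>j\<in>UNIV. A $ l $ j *s (gen (lagr k) \<or>\<^sub>C gen (gdual (lagr j)))))"
    unfolding quad_def[of B]
    by (simp add: linear_sum[of "poisson_expr a" "\<lambda>_. 1" for a, simplified] poisson_expr_linear
        poisson_expr_leibniz_right[OF inv_quad] poisson_quad_gen vee_sum vec.scale_right_diff_distrib sum_subtractf)
  also have "(\<Sum>k\<in>UNIV. \<Sum>l\<in>UNIV. B $ k $ l *s (\<Sum>i\<in>UNIV. A $ i $ k *s (gen (lagr i) \<or>\<^sub>C gen (gdual (lagr l))))) = quad (A ** B)"
  proof -
    have "quad (A ** B) = (\<Sum>i\<in>UNIV. \<Sum>l\<in>UNIV. \<Sum>k\<in>UNIV. (A $ i $ k * B $ k $ l) *s (gen (lagr i) \<or>\<^sub>C gen (gdual (lagr l))))"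
      by (simp add: quad_def matrix_matrix_mult_def vec.scale_sum_left)
    also have "\<dots> = (\<Sum>i\<in>UNIV. \<Sum>k\<in>UNIV. \<Sum>l\<in>UNIV. (A $ i $ k * B $ k $ l) *s (gen (lagr i) \<or>\<^sub>C gen (gdual (lagr l))))"
      by (intro sum.cong refl sum.swap)
    also have "\<dots> = (\<Sum>k\<in>UNIV. \<Sum>i\<in>UNIV. \<Sum>l\<in>UNIV. (A $ i $ k * B $ k $ l) *s (gen (lagr i) \<or>\<^sub>C gen (gdual (lagr l))))"
      by (rule sum.swap)
    also have "\<dots> = (\<Sum>k\<in>UNIV. \<Sum>l\<in>UNIV. \<Sum>i\<in>UNIV. (A $ i $ k * B $ k $ l) *s (gen (lagr i) \<or>\<^sub>C gen (gdual (lagr l))))"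
      by (intro sum.cong refl sum.swap)
    finally show ?thesis by (simp add: vec.scale_sum_right mult.commute)
  qed
  also have "(\<Sum>k\<in>UNIV. \<Sum>l\<in>UNIV. B $ k $ l *s (\<Sum>j\<in>UNIV. A $ l $ j *s (gen (lagr k) \<or>\<^sub>C gen (gdual (lagr j))))) = quad (B ** A)"
  proof -
    have "quad (B ** A) = (\<Sum>k\<in>UNIV. \<Sum>j\<in>UNIV. \<Sum>l\<in>UNIV. (B $ k $ l * A $ l $ j) *s (gen (lagr k) \<or>\<^sub>C gen (gdual (lagr j))))"
      by (simp add: quad_def matrix_matrix_mult_def vec.scale_sum_left)
    also have "\<dots> = (\<Sum>k\<in>UNIV. \<Sum>l\<in>UNIV. \<Sum>j\<in>UNIV. (B $ k $ l * A $ l $ j) *s (gen (lagr k) \<or>\<^sub>C gen (gdual (lagr j))))"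
      by (intro sum.cong refl sum.swap)
    finally show ?thesis by (simp add: vec.scale_sum_right)
  qed
  finally show ?thesis by (simp add: quad_linear)
qed

lemma UNIV_heis: "UNIV = {X\<^sub>1, X\<^sub>m\<^sub>1, H\<^sub>0}"
  using heis.exhaust by blast

text \<open>
  As \<open>\<mu> = t\<^sub>1 t\<^sub>2 t\<^sub>3\<close> lives on \<open>L\<close> alone, only derivatives in the directions of the dual basis occur, and their
  coefficients \<open>\<partial>\<mu>/\<partial>t\<^sub>i = t\<^sub>i\<^sub>+\<^sub>1 t\<^sub>i\<^sub>+\<^sub>2\<close> are cyclic.
\<close>

lemma ce_diff_heisenberg:
  "ce_diff heisenberg f = (\<Sum>i\<in>UNIV. gen (lagr (i + 1)) \<or>\<^sub>C (gen (lagr (i + 2)) \<or>\<^sub>C dv (gdual (lagr i)) f))"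
proof -
  have mu: "bracket_cochain heisenberg = gen (lagr 1) \<or>\<^sub>C (gen (lagr 2) \<or>\<^sub>C gen (lagr 3))"
  proof -
    have e: "{j. j = X\<^sub>m\<^sub>1 \<and> j < X\<^sub>1} = {}" by (auto simp: less_heis_def)
    show ?thesis
      by (simp add: bracket_cochain_heisenberg gen.simps(2)) (simp add: gen_vee_axis e)
  qed
  have U: "(\<Sum>g\<in>UNIV. F g) = F (Inl X\<^sub>1) + F (Inl X\<^sub>m\<^sub>1) + F (Inl H\<^sub>0) + F (Inr X\<^sub>1) + F (Inr X\<^sub>m\<^sub>1) + F (Inr H\<^sub>0)"
    for F :: "heis + heis \<Rightarrow> ('a, heis) cochain"
    by (simp add: UNIV_sum sum.union_disjoint sum.reindex UNIV_heis)
  have n: "(1::3) + 1 = 2" "(1::3) + 2 = 3" "(2::3) + 1 = 3" "(2::3) + 2 = 1" "(3::3) + 1 = 1" "(3::3) + 2 = 2"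
    by simp_all
  have a: "gen (Inr H\<^sub>0) \<or>\<^sub>C (gen (Inl X\<^sub>1) \<or>\<^sub>C x) = - (gen (Inl X\<^sub>1) \<or>\<^sub>C (gen (Inr H\<^sub>0) \<or>\<^sub>C x))" for x :: "('a, heis) cochain"
    by (simp add: gen_anticommute[of "Inr H\<^sub>0" "Inl X\<^sub>1"] flip: vee_assoc)
  show ?thesis
    unfolding ce_diff_def poisson_eq mu poisson_expr_def
    by (simp add: U sum_3 n a dv_gen_vee dv_gen inv_gen_vee inv_gen inv_one vee_assoc del: add_2_eq_Suc add_2_eq_Suc' one_add_one)
qed

section \<open>Coordinates of cochains\<close>

text \<open>
  Cochains have 64 coordinates. Writing an index as six truth values, for \<open>a, b, c, x, y, h\<close> in this
  order, lets the simplifier compute every coordinate of a product or derivative, signs included. The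
  purely linear facts on the differential are obtained in this way.
\<close>

definition heis_set :: "bool \<Rightarrow> bool \<Rightarrow> bool \<Rightarrow> heis set" where
  "heis_set a b c = {j. case j of X\<^sub>1 \<Rightarrow> a | X\<^sub>m\<^sub>1 \<Rightarrow> b | H\<^sub>0 \<Rightarrow> c}"

abbreviation idx :: "bool \<Rightarrow> bool \<Rightarrow> bool \<Rightarrow> bool \<Rightarrow> bool \<Rightarrow> bool \<Rightarrow> heis set \<times> heis set" where
  "idx a b c x y h \<equiv> (heis_set a b c, heis_set x y h)"

lemma heis_set_surj: "I = heis_set (X\<^sub>1 \<in> I) (X\<^sub>m\<^sub>1 \<in> I) (H\<^sub>0 \<in> I)"
proof (rule set_eqI)
  fix j show "j \<in> I \<longleftrightarrow> j \<in> heis_set (X\<^sub>1 \<in> I) (X\<^sub>m\<^sub>1 \<in> I) (H\<^sub>0 \<in> I)"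
    by (cases j) (simp_all add: heis_set_def)
qed

lemma cochain_eq_iff:
  "u = v \<longleftrightarrow> (\<forall>a b c x y h. u $ idx a b c x y h = (v $ idx a b c x y h :: 'k))"
proof -
  have "\<exists>a b c x y h. s = idx a b c x y h" for s
    using heis_set_surj[of "fst s"] heis_set_surj[of "snd s"] by (metis prod.collapse)
  then show ?thesis unfolding vec_eq_iff by metis
qed

lemma card_heis: "card {j. P j} = of_bool (P X\<^sub>1) + of_bool (P X\<^sub>m\<^sub>1) + of_bool (P H\<^sub>0)"
proof -
  have "card {j. P j} = (\<Sum>j\<in>UNIV. of_bool (P j))" by simp
  also have "\<dots> = of_bool (P X\<^sub>1) + of_bool (P X\<^sub>m\<^sub>1) + of_bool (P H\<^sub>0)" by (simp add: UNIV_heis)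
  finally show ?thesis .
qed

lemma idx_simps:
  "gmem (Inl X\<^sub>1) (idx a b c x y h) = a" "gmem (Inl X\<^sub>m\<^sub>1) (idx a b c x y h) = b" "gmem (Inl H\<^sub>0) (idx a b c x y h) = c"
  "gmem (Inr X\<^sub>1) (idx a b c x y h) = x" "gmem (Inr X\<^sub>m\<^sub>1) (idx a b c x y h) = y" "gmem (Inr H\<^sub>0) (idx a b c x y h) = h"
  "gins (Inl X\<^sub>1) (idx a b c x y h) = idx True b c x y h" "gins (Inl X\<^sub>m\<^sub>1) (idx a b c x y h) = idx a True c x y h"
  "gins (Inl H\<^sub>0) (idx a b c x y h) = idx a b True x y h" "gins (Inr X\<^sub>1) (idx a b c x y h) = idx a b c True y h"
  "gins (Inr X\<^sub>m\<^sub>1) (idx a b c x y h) = idx a b c x True h" "gins (Inr H\<^sub>0) (idx a b c x y h) = idx a b c x y True"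
  "gdel (Inl X\<^sub>1) (idx a b c x y h) = idx False b c x y h" "gdel (Inl X\<^sub>m\<^sub>1) (idx a b c x y h) = idx a False c x y h"
  "gdel (Inl H\<^sub>0) (idx a b c x y h) = idx a b False x y h" "gdel (Inr X\<^sub>1) (idx a b c x y h) = idx a b c False y h"
  "gdel (Inr X\<^sub>m\<^sub>1) (idx a b c x y h) = idx a b c x False h" "gdel (Inr H\<^sub>0) (idx a b c x y h) = idx a b c x y False"
  "gpos (Inl X\<^sub>1) (idx a b c x y h) = 0" "gpos (Inl X\<^sub>m\<^sub>1) (idx a b c x y h) = of_bool a"
  "gpos (Inl H\<^sub>0) (idx a b c x y h) = of_bool a + of_bool b"
  "gpos (Inr X\<^sub>1) (idx a b c x y h) = of_bool a + of_bool b + of_bool c"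
  "gpos (Inr X\<^sub>m\<^sub>1) (idx a b c x y h) = of_bool a + of_bool b + of_bool c + of_bool x"
  "gpos (Inr H\<^sub>0) (idx a b c x y h) = of_bool a + of_bool b + of_bool c + of_bool x + of_bool y"
  "size2 (idx a b c x y h) = of_bool a + of_bool b + of_bool c + of_bool x + of_bool y + of_bool h"
  by (auto simp: heis_set_def size2_def card_heis less_heis_def split: heis.splits)

lemma heis_set_eq_iff: "heis_set a b c = heis_set a' b' c' \<longleftrightarrow> a = a' \<and> b = b' \<and> c = c'"
  by (auto simp: heis_set_def set_eq_iff split: heis.splits)

lemma axis_coord: "axis u x $ s = (if s = u then x else 0)"
  by (simp add: axis_def)

lemma unit_coord: "unit_cochain $ idx a b c x y h = (if a \<or> b \<or> c \<or> x \<or> y \<or> h then 0 else 1)"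
proof -
  have "heis_set a b c = {} \<longleftrightarrow> \<not> a \<and> \<not> b \<and> \<not> c" for a b c
    by (auto simp: heis_set_def set_eq_iff split: heis.splits)
  then show ?thesis by (simp add: axis_coord)
qed

lemma vee_gen_coord: "(gen g \<or>\<^sub>C c) $ s = (if gmem g s then (-1) ^ gpos g s * c $ gdel g s else 0)"
proof (induction c rule: cochain_induct)
  case (axis u)
  have "gpos g s = gpos g (gdel g s)" if "gmem g s"
    using gpos_gdel[OF that, of g] by simp
  moreover have "s = gins g u \<longleftrightarrow> gmem g s \<and> gdel g s = u" if "\<not> gmem g u"
    using that by (metis g_simps(1,5,6))
  moreover have "gdel g s \<noteq> u" if "gmem g u" using that by auto
  ultimately show ?case by (auto simp: gen_vee_axis axis_coord)
qed (simp_all add: algebra_simps)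

lemma dv_coord: "dv g c $ s = (if gmem g s then 0 else (-1) ^ gpos g s * c $ gins g s)"
proof (induction c rule: cochain_induct)
  case (axis u)
  have "gpos g (gins g s) = gpos g s" if "\<not> gmem g s"
    using gpos_gins[OF that, of g] by simp
  moreover have "s = gdel g u \<longleftrightarrow> \<not> gmem g s \<and> gins g s = u" if "gmem g u"
    using that by (metis g_simps(2,5,6))
  moreover have "gins g s \<noteq> u" if "\<not> gmem g u" using that by auto
  ultimately show ?case by (auto simp: dv_axis axis_coord)
qed (simp_all add: algebra_simps)

text \<open>
  These would rewrite \<open>gins (Inl X\<^sub>1) (idx a b c x y h)\<close> and its relatives into explicit insertions before
  \<open>idx_simps\<close> applies.
\<close>

declare gmem.simps [simp del] gins.simps [simp del] gdel.simps [simp del] gpos.simps [simp del]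

lemmas coord = vee_gen_coord dv_coord idx_simps unit_coord

lemma gen_coord: "gen g $ s = (if gmem g s then (-1) ^ gpos g s * unit_cochain $ gdel g s else 0)"
  using vee_gen_coord[of g unit_cochain s] by simp

lemma idx_ends: "({}, {}) = idx False False False False False False" "(UNIV, UNIV) = idx True True True True True True"
  by (auto simp: heis_set_def split: heis.splits)

section \<open>Representative cocycles\<close>

definition traceless :: "'k ^ 3 ^ 3 \<Rightarrow> 'k::field ^ 3 ^ 3" where
  "traceless A = A - mat (trace A / 3)"

text \<open>The canonical element \<open>\<Sum> t\<^sub>i t\<^sub>i\<^sup>*\<close> of \<open>L \<otimes> L\<^sup>*\<close>; its bracket with a cochain of degree \<open>(p, q)\<close> in \<open>\<Lambda> L \<otimes> \<Lambda> L\<^sup>*\<close>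
  multiplies it by \<open>p - q\<close>.\<close>

abbreviation eps :: "('k::field, heis) cochain" where
  "eps \<equiv> quad (mat 1)"

text \<open>
  \<open>Q(A)\<close> is closed only if \<open>tr A = 0\<close>, and \<open>Q(1) \<epsilon> = \<epsilon>\<^sup>2\<close> is exact. The trace of \<open>A\<close> and the trace of
  \<open>B\<close> are therefore stored in the lowest and the highest degree, where classes commute with all others.
\<close>

definition cocycle_of :: "'k ^ 3 ^ 3 \<Rightarrow> 'k ^ 3 ^ 3 \<Rightarrow> ('k::field, heis) cochain" where
  "cocycle_of A B = trace A *s unit_cochain + quad (traceless A) + quad B \<or>\<^sub>C eps + trace B *s (eps \<or>\<^sub>C (eps \<or>\<^sub>C eps))"

text \<open>The coefficients of the \<open>t\<^sub>i t\<^sub>j\<^sup>*\<close>; iterated derivatives avoid the signs of the ordering.\<close>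

definition bilinear_part :: "('k::field, heis) cochain \<Rightarrow> 'k ^ 3 ^ 3" where
  "bilinear_part c = (\<chi> i j. dv (gdual (lagr j)) (dv (lagr i) c) $ ({}, {}))"

text \<open>Contraction with \<open>\<epsilon>\<close> inverts multiplication by \<open>\<epsilon>\<close> up to trace: it maps \<open>Q(B) \<epsilon>\<close> to \<open>Q(B + tr B)\<close>.\<close>

definition eps_contraction :: "('k::field, heis) cochain \<Rightarrow> ('k, heis) cochain" where
  "eps_contraction c = (\<Sum>i\<in>UNIV. dv (gdual (lagr i)) (dv (lagr i) c))"

text \<open>
  Left inverses of \<open>cocycle_of\<close>, one for each matrix. Dividing by 3 distributes the stored trace over the diagonal;
  the divisor 18 contains in addition the factor 6 by which \<open>\<epsilon>\<^sup>3\<close> exceeds the top monomial.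
\<close>

definition gl_part :: "('k::field, heis) cochain \<Rightarrow> 'k ^ 3 ^ 3" where
  "gl_part c = traceless (bilinear_part c) + mat (c $ ({}, {}) / 3)"

definition abelian_part :: "('k::field, heis) cochain \<Rightarrow> 'k ^ 3 ^ 3" where
  "abelian_part c = traceless (bilinear_part (eps_contraction c)) + mat (c $ (UNIV, UNIV) / 18)"

lemma mat_entry: "mat c $ i $ j = (if i = j then c else (0 :: 'k::field))" for i j :: 3
  by (simp add: mat_def)

lemma ce_diff_heisenberg_explicit: "ce_diff heisenberg c =
  gen (Inl X\<^sub>m\<^sub>1) \<or>\<^sub>C (gen (Inr H\<^sub>0) \<or>\<^sub>C dv (Inr X\<^sub>1) c) +
  gen (Inr H\<^sub>0) \<or>\<^sub>C (gen (Inl X\<^sub>1) \<or>\<^sub>C dv (Inr X\<^sub>m\<^sub>1) c) +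
  gen (Inl X\<^sub>1) \<or>\<^sub>C (gen (Inl X\<^sub>m\<^sub>1) \<or>\<^sub>C dv (Inl H\<^sub>0) c)"
  by (simp add: ce_diff_heisenberg sum_3)

lemma ce_diff_squared: "ce_diff heisenberg (ce_diff heisenberg c) = 0"
  unfolding cochain_eq_iff all_bool_eq
  by (simp add: ce_diff_heisenberg_explicit sum_3 coord)

lemma gl_part_ce_diff: "gl_part (ce_diff heisenberg c) = 0"
  by (simp add: gl_part_def traceless_def bilinear_part_def vec_eq_iff forall_3 trace_def mat_entry idx_ends
     ce_diff_heisenberg_explicit sum_3 coord)

text \<open>
  The component of \<open>d c\<close> in \<open>\<Lambda>\<^sup>2 L \<otimes> \<Lambda>\<^sup>2 L\<^sup>*\<close> is a multiple of \<open>\<epsilon>\<^sup>2\<close>, whose contraction is a multiple of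
  \<open>\<epsilon>\<close> and hence has no traceless part.
\<close>

lemma abelian_part_ce_diff: "abelian_part (ce_diff heisenberg c :: ('k::field_char_0, heis) cochain) = 0"
  by (simp add: abelian_part_def traceless_def bilinear_part_def vec_eq_iff forall_3 trace_def mat_entry idx_ends
     eps_contraction_def ce_diff_heisenberg_explicit sum_3 coord)

lemma parts_diff: "gl_part (a - b) = gl_part a - gl_part b" "abelian_part (a - b) = abelian_part a - abelian_part b"
  for a b :: "('k::field, heis) cochain"
  by (auto simp: gl_part_def abelian_part_def bilinear_part_def eps_contraction_def dv_diff traceless_def trace_def sum_subtractf vec_eq_iff mat_entry diff_divide_distrib dv_sum)

lemma quad_vee_explicit: "quad A \<or>\<^sub>C c =
  A$1$1 *s (gen (Inl X\<^sub>1) \<or>\<^sub>C (gen (Inr X\<^sub>1) \<or>\<^sub>C c)) +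
  A$1$2 *s (gen (Inl X\<^sub>1) \<or>\<^sub>C (gen (Inr X\<^sub>m\<^sub>1) \<or>\<^sub>C c)) +
  A$1$3 *s (gen (Inl X\<^sub>1) \<or>\<^sub>C (gen (Inl H\<^sub>0) \<or>\<^sub>C c)) +
  A$2$1 *s (gen (Inl X\<^sub>m\<^sub>1) \<or>\<^sub>C (gen (Inr X\<^sub>1) \<or>\<^sub>C c)) +
  A$2$2 *s (gen (Inl X\<^sub>m\<^sub>1) \<or>\<^sub>C (gen (Inr X\<^sub>m\<^sub>1) \<or>\<^sub>C c)) +
  A$2$3 *s (gen (Inl X\<^sub>m\<^sub>1) \<or>\<^sub>C (gen (Inl H\<^sub>0) \<or>\<^sub>C c)) +
  A$3$1 *s (gen (Inr H\<^sub>0) \<or>\<^sub>C (gen (Inr X\<^sub>1) \<or>\<^sub>C c)) +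
  A$3$2 *s (gen (Inr H\<^sub>0) \<or>\<^sub>C (gen (Inr X\<^sub>m\<^sub>1) \<or>\<^sub>C c)) +
  A$3$3 *s (gen (Inr H\<^sub>0) \<or>\<^sub>C (gen (Inl H\<^sub>0) \<or>\<^sub>C c))"
  by (simp add: quad_vee sum_3)

lemma eps_vee_explicit: "eps \<or>\<^sub>C c =
  gen (Inl X\<^sub>1) \<or>\<^sub>C (gen (Inr X\<^sub>1) \<or>\<^sub>C c) +
  gen (Inl X\<^sub>m\<^sub>1) \<or>\<^sub>C (gen (Inr X\<^sub>m\<^sub>1) \<or>\<^sub>C c) +
  gen (Inr H\<^sub>0) \<or>\<^sub>C (gen (Inl H\<^sub>0) \<or>\<^sub>C c)"
  by (simp add: quad_vee_explicit mat_entry)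

text \<open>With the factor 1 on the right, the expansion rules for products apply to \<open>Q(A)\<close> itself.\<close>

lemma quad_coord: "quad A $ s = (quad A \<or>\<^sub>C unit_cochain) $ s"
  by simp

lemma trace_traceless: "trace (traceless A) = (0 :: 'k::field_char_0)"
  by (simp add: trace_def traceless_def sum_3 mat_entry field_simps)

lemma traceless_id: "trace A = 0 \<Longrightarrow> traceless A = (A :: 'k::field_char_0 ^ 3 ^ 3)"
  by (simp add: traceless_def vec_eq_iff mat_entry)

lemma ce_diff_quad:
  assumes "trace A = 0"
  shows "ce_diff heisenberg (quad A) = 0"
proof -
  have "A $ 3 $ 3 = - A $ 1 $ 1 - A $ 2 $ 2"
    using assms by (simp add: trace_def sum_3 eq_neg_iff_add_eq_0 algebra_simps)
  then show ?thesis
    unfolding cochain_eq_iff all_bool_eq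
    by (simp add: ce_diff_heisenberg_explicit coord quad_coord quad_vee_explicit del: vee_one)
qed

lemma ce_diff_quad_eps: "ce_diff heisenberg (quad B \<or>\<^sub>C eps) = 0"
  unfolding cochain_eq_iff all_bool_eq
  by (simp add: ce_diff_heisenberg_explicit  coord quad_coord quad_vee_explicit eps_vee_explicit mat_entry del: vee_one)

lemma top_coord: "axis (UNIV, UNIV) k $ idx a b c x y h = (if a \<and> b \<and> c \<and> x \<and> y \<and> h then k else 0)"
  by (simp add: idx_ends(2) axis_coord heis_set_eq_iff)

text \<open>
  A product of three elements of \<open>L \<otimes> L\<^sup>*\<close> lies in the one-dimensional top degree, and up to a factor the
  only invariant linear form on matrices is the trace. For \<open>A = 1\<close> this gives \<open>\<epsilon>\<^sup>3 = 6\<close> times the top monomial.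
\<close>

lemma quad_eps_eps: "quad A \<or>\<^sub>C (eps \<or>\<^sub>C eps) = axis (UNIV, UNIV) (2 * trace A)"
  unfolding cochain_eq_iff all_bool_eq
  by (simp add: coord quad_coord quad_vee_explicit eps_vee_explicit mat_entry trace_def sum_3 top_coord del: vee_one)

lemma ce_diff_top: "ce_diff heisenberg (axis (UNIV, UNIV) k) = 0"
  unfolding cochain_eq_iff all_bool_eq
  by (simp add: ce_diff_heisenberg_explicit coord top_coord)

lemma ce_diff_one: "ce_diff heisenberg unit_cochain = 0"
  unfolding cochain_eq_iff all_bool_eq
  by (simp add: ce_diff_heisenberg_explicit coord)

lemma trace_mat: "trace (mat k :: 'k::field ^ 3 ^ 3) = 3 * k"
  by (simp add: trace_def mat_entry)

lemma gl_part_cocycle_of: "gl_part (cocycle_of A B :: ('k::field_char_0, heis) cochain) = A"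
  unfolding cocycle_of_def quad_eps_eps trace_mat
  by (simp add: gl_part_def traceless_def bilinear_part_def vec_eq_iff forall_3 trace_def mat_entry
     sum_3 coord quad_coord quad_vee_explicit eps_vee_explicit axis_coord heis_set_eq_iff idx_ends del: vee_one) (auto simp: field_simps)

lemma abelian_part_cocycle_of: "abelian_part (cocycle_of A B :: ('k::field_char_0, heis) cochain) = B"
  unfolding cocycle_of_def quad_eps_eps trace_mat
  by (simp add: abelian_part_def eps_contraction_def traceless_def bilinear_part_def vec_eq_iff forall_3 trace_def mat_entry idx_ends
     sum_3 coord quad_coord quad_vee_explicit eps_vee_explicit axis_coord heis_set_eq_iff del: vee_one) (auto simp: field_simps)

section \<open>Brackets of the representatives\<close>

lemma commutator_traceless:
  "traceless A ** B - B ** traceless A = A ** B - B ** A"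
  "A ** traceless B - traceless B ** A = A ** B - B ** A"
proof -
  have "mat c ** B = B ** mat c" for c and B :: "'a ^ 3 ^ 3"
  proof -
    have "mat c = mscale c (mat 1 :: 'a ^ 3 ^ 3)" by (simp add: mscale_def vec_eq_iff mat_def)
    then show ?thesis by (simp add: matrix_mult_bilinear)
  qed
  then show "traceless A ** B - B ** traceless A = A ** B - B ** A"
    "A ** traceless B - traceless B ** A = A ** B - B ** A"
    by (simp_all add: traceless_def matrix_mult_bilinear)
qed

lemma trace_zero: "trace 0 = 0"
  by (simp add: trace_def)

lemma trace_commutator: "trace (A ** B - B ** A) = (0 :: 'k::field)"
  by (simp add: trace_sub trace_mul_sym[of A B])

lemma quad_0: "quad 0 = 0"
  by (simp add: quad_def)

lemma inv_quad_eps: "grade_inv (quad A \<or>\<^sub>C eps) = quad A \<or>\<^sub>C eps" "grade_inv (eps \<or>\<^sub>C (eps \<or>\<^sub>C eps)) = eps \<or>\<^sub>C (eps \<or>\<^sub>C eps)"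
  by (simp_all add: inv_vee inv_quad)

lemma poisson_quad_eps: "poisson_expr (quad A) eps = 0"
  by (simp add: poisson_quad_quad quad_0)

lemma poisson_quad_quad_eps: "poisson_expr (quad A) (quad B \<or>\<^sub>C eps) = quad (A ** B - B ** A) \<or>\<^sub>C eps"
  by (simp add: poisson_expr_leibniz_right[OF inv_quad] poisson_quad_quad poisson_quad_eps quad_0)

lemma poisson_quad_eps_eps: "poisson_expr (quad A \<or>\<^sub>C eps) eps = 0"
  using poisson_expr_skew_even[OF inv_quad_eps(1)[of A] inv_quad[of "mat 1"]]
  by (simp add: poisson_quad_quad_eps quad_0)

text \<open>
  The bracket is \<open>Q([A, B]) \<epsilon>\<^sup>2\<close>, and commutators have trace zero: this is why the second factor of the semidirect
  product is abelian.
\<close>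

lemma poisson_quad_eps_quad_eps:
  fixes A B :: "'k::field ^ 3 ^ 3"
  shows "poisson_expr (quad A \<or>\<^sub>C eps) (quad B \<or>\<^sub>C eps) = 0"
proof -
  have "poisson_expr (quad A \<or>\<^sub>C eps) (quad B) = - (quad (B ** A - A ** B) \<or>\<^sub>C eps)"
    using poisson_expr_skew_even[OF inv_quad_eps(1)[of A] inv_quad[of B]]
    by (simp add: poisson_quad_quad_eps)
  then have "poisson_expr (quad A \<or>\<^sub>C eps) (quad B \<or>\<^sub>C eps) = - (quad (B ** A - A ** B) \<or>\<^sub>C (eps \<or>\<^sub>C eps))"
    by (simp add: poisson_expr_leibniz_right[OF inv_quad_eps(1)] poisson_quad_eps_eps vee_assoc)
  then show ?thesis by (simp add: quad_eps_eps trace_commutator axis_def vec_eq_iff)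
qed

lemma poisson_eps_cube:
  assumes "poisson_expr a eps = 0" "grade_inv a = a"
  shows "poisson_expr a (eps \<or>\<^sub>C (eps \<or>\<^sub>C eps)) = 0" "poisson_expr (eps \<or>\<^sub>C (eps \<or>\<^sub>C eps)) a = 0"
proof -
  show "poisson_expr a (eps \<or>\<^sub>C (eps \<or>\<^sub>C eps)) = 0"
    by (simp add: poisson_expr_leibniz_right assms)
  then show "poisson_expr (eps \<or>\<^sub>C (eps \<or>\<^sub>C eps)) a = 0"
    using poisson_expr_skew_even[OF inv_quad_eps(2) assms(2)] by simp
qed

lemma poisson_unit: "poisson_expr unit_cochain a = 0" "poisson_expr a unit_cochain = 0"
  by (simp_all add: poisson_expr_def)

text \<open>
  The trace terms are central, being polynomials in \<open>\<epsilon>\<close>, and scalar matrices drop out of commutators.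
  What is left is \<open>{Q(A) + Q(B) \<epsilon>, Q(C) + Q(D) \<epsilon>}\<close>. The result is already in the form of \<open>cocycle_of\<close>
  as both commutators are traceless.
\<close>

lemma poisson_cocycle_of:
  fixes A B C D :: "'k::field_char_0 ^ 3 ^ 3"
  shows "poisson_expr (cocycle_of A B) (cocycle_of C D) = cocycle_of (A ** C - C ** A) ((A ** D - D ** A) - (C ** B - B ** C))"
proof -
  have e: "poisson_expr (quad A \<or>\<^sub>C eps) (quad C) = - (quad (C ** A - A ** C) \<or>\<^sub>C eps)" for A C :: "'k ^ 3 ^ 3"
    using poisson_expr_skew_even[OF inv_quad_eps(1)[of A] inv_quad[of C]]
    by (simp add: poisson_quad_quad_eps)
  have "trace (A ** C - C ** A) = 0" "trace ((A ** D - D ** A) - (C ** B - B ** C)) = 0"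
    by (simp_all add: trace_sub[of "A ** D - D ** A"] trace_commutator)
  then show ?thesis
    unfolding cocycle_of_def
    by (simp add: poisson_expr_linear poisson_unit poisson_eps_cube poisson_quad_eps poisson_quad_eps_eps inv_quad inv_quad_eps
      poisson_quad_quad poisson_quad_quad_eps poisson_quad_eps_quad_eps e commutator_traceless traceless_id quad_0 quad_linear(2)[of "A ** D - D ** A"] vee_diff)
qed

lemma cocycle_of_linear:
  fixes A B C D :: "'k::field ^ 3 ^ 3"
  shows "cocycle_of (A + C) (B + D) = cocycle_of A B + cocycle_of C D" "cocycle_of (mscale k A) (mscale k B) = k *s cocycle_of A B" "cocycle_of 0 0 = (0 :: ('k, heis) cochain)"
proof -
  have "traceless (A + C) = traceless A + traceless C" "traceless (mscale k A) = mscale k (traceless A)"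
    by (simp_all add: traceless_def mscale_def vec_eq_iff mat_entry trace_def sum_3 algebra_simps add_divide_distrib)
  moreover have "trace (mscale k A) = k * trace A" for A :: "'k ^ 3 ^ 3"
    by (simp add: trace_def mscale_def sum_distrib_left)
  ultimately show "cocycle_of (A + C) (B + D) = cocycle_of A B + cocycle_of C D" "cocycle_of (mscale k A) (mscale k B) = k *s cocycle_of A B"
    by (simp_all add: cocycle_of_def trace_add quad_linear(1) quad_linear(3)[folded mscale_def] vec.scale_left_distrib vec.scale_right_distrib)
  show "cocycle_of 0 0 = 0"
    by (simp add: cocycle_of_def traceless_def trace_zero quad_0)
qed

section \<open>Every even cocycle is cohomologous to a representative\<close>

lemma cocycle_of_cocycle: "cocycle_of A B \<in> even_cocycles heisenberg"
  for A B :: "'k::field_char_0 ^ 3 ^ 3"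
proof -
  have "eps \<or>\<^sub>C (eps \<or>\<^sub>C eps) = (axis (UNIV, UNIV) 6 :: ('k, heis) cochain)"
    by (simp add: quad_eps_eps trace_mat)
  then have "ce_diff heisenberg (cocycle_of A B) = 0"
    by (simp add: cocycle_of_def ce_diff_linear ce_diff_quad trace_traceless ce_diff_quad_eps ce_diff_top ce_diff_one)
  then show ?thesis
    by (simp add: even_cocycles_def cocycle_of_def inv_quad inv_quad_eps inv_one)
qed

lemma coboundaries_cocycles: "even_coboundaries heisenberg \<subseteq> (even_cocycles heisenberg :: ('k::field_char_0, heis) cochain set)"
  using ce_diff_linear(2)[of heisenberg "-1 :: 'k"]
  by (auto simp: even_coboundaries_eq odd_cochains_def even_cocycles_def ce_diff_squared inv_ce_diff)

text \<open>
  The components of an even cocycle with both parts zero are settled degree by degree in \<open>\<Lambda>\<^sup>p L \<otimes> \<Lambda>\<^sup>q L\<^sup>*\<close>. Closedness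
  removes \<open>\<Lambda>\<^sup>2 L\<^sup>*\<close>, \<open>L \<otimes> \<Lambda>\<^sup>3 L\<^sup>*\<close> and the trace on \<open>L \<otimes> L\<^sup>*\<close>; the vanishing parts remove the rest of
  \<open>L \<otimes> L\<^sup>*\<close>, the scalars and the top degree, and reduce \<open>\<Lambda>\<^sup>2 L \<otimes> \<Lambda>\<^sup>2 L\<^sup>*\<close> to multiples of \<open>\<epsilon>\<^sup>2\<close>. A primitive of what
  remains is found from
    \<open>d t\<^sub>i\<^sup>* = t\<^sub>i\<^sub>+\<^sub>1 t\<^sub>i\<^sub>+\<^sub>2\<close>, \<open>d (t\<^sub>i\<^sub>+\<^sub>1 t\<^sub>i\<^sub>+\<^sub>1\<^sup>* t\<^sub>i\<^sup>*) = - \<mu> t\<^sub>i\<^sup>*\<close> and \<open>d (t\<^sub>1\<^sup>* t\<^sub>2\<^sup>* t\<^sub>3\<^sup>*) = - \<epsilon>\<^sup>2 / 2\<close>.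
\<close>

lemma even_cocycle_exact:
  fixes c :: "('k::field_char_0, heis) cochain"
  assumes c: "c \<in> even_cocycles heisenberg" and gl: "gl_part c = 0" and ab: "abelian_part c = 0"
  shows "c \<in> even_coboundaries heisenberg"
proof -
  have odd0: "c $ idx a b d x y h = 0" if "odd (size2 (idx a b d x y h))" for a b d x y h
  proof -
    have "(-1) ^ size2 (idx a b d x y h) * c $ idx a b d x y h = c $ idx a b d x y h"
      using c by (simp add: even_cocycles_def grade_inv_def vec_eq_iff)
    then show ?thesis using that by simp
  qed
  have dc: "ce_diff heisenberg c $ s = 0" for s
    using c by (simp add: even_cocycles_def)
  \<comment> \<open>the coefficient of \<open>\<mu>\<close> in \<open>d c\<close>\<close>
  have "trace (bilinear_part c) = 0"
    using dc[of "idx True True False False False True"]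
    by (simp add: trace_def sum_3 bilinear_part_def idx_ends(1) ce_diff_heisenberg_explicit coord algebra_simps)
  then have p: "bilinear_part c + mat (c $ ({}, {}) / 3) = 0"
    using gl by (simp add: gl_part_def traceless_id)
  from arg_cong[OF this, of trace] \<open>trace (bilinear_part c) = 0\<close> have "c $ ({}, {}) = 0"
    by (simp add: trace_add trace_mat trace_zero)
  with p have P: "bilinear_part c $ i $ j = 0" and c0: "c $ ({}, {}) = 0" for i j
    by (simp_all add: mat_0)
  have top: "c $ (UNIV, UNIV) = 0"
    using arg_cong[OF ab, of trace] by (simp add: abelian_part_def trace_traceless trace_add trace_mat trace_zero)
  then have "traceless (bilinear_part (eps_contraction c)) = 0" using ab by (simp add: abelian_part_def mat_entry vec_eq_iff)
  then have K: "bilinear_part (eps_contraction c) $ i $ j = (if i = j then trace (bilinear_part (eps_contraction c)) / 3 else 0)" for i j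
    by (simp add: traceless_def mat_entry flip: mat_entry[of "_ / 3"])
  define l where "l = trace (bilinear_part (eps_contraction c)) / 3"
  \<comment> \<open>\<open>\<Lambda>\<^sup>2 L\<^sup>*\<close> and \<open>L \<otimes> \<Lambda>\<^sup>3 L\<^sup>*\<close>: each coefficient reappears as a single coefficient of \<open>d c\<close>\<close>
  have cz:
    "c $ idx False False False True True False = 0"
    "c $ idx False False True True False False = 0"
    "c $ idx False False True False True False = 0"
    "c $ idx True False True True True False = 0"
    "c $ idx False True True True True False = 0"
    "c $ idx False False True True True True = 0"
    using dc[of "idx False True False False True True"]
      dc[of "idx False True True False False True"]
      dc[of "idx True False True False False True"]
      dc[of "idx True True True False True True"]
      dc[of "idx True True True True False True"]
      dc[of "idx True True False True True True"]
    by (simp_all add: ce_diff_heisenberg_explicit coord odd0)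
  have bil: "\<forall>i j. bilinear_part c $ i $ j = 0" and con: "\<forall>i j. bilinear_part (eps_contraction c) $ i $ j = (if i = j then l else 0)"
    using P K by (simp_all add: l_def)
  \<comment> \<open>\<open>L \<otimes> L\<^sup>*\<close>\<close>
  have pz:
    "c $ idx True False False True False False = 0"
    "c $ idx True False False False True False = 0"
    "c $ idx True False True False False False = 0"
    "c $ idx False True False True False False = 0"
    "c $ idx False True False False True False = 0"
    "c $ idx False True True False False False = 0"
    "c $ idx False False False True False True = 0"
    "c $ idx False False False False True True = 0"
    "c $ idx False False True False False True = 0"
    using bil[rule_format, of 1 1] bil[rule_format, of 1 2] bil[rule_format, of 1 3] bil[rule_format, of 2 1] bil[rule_format, of 2 2] bil[rule_format, of 2 3]
      bil[rule_format, of 3 1] bil[rule_format, of 3 2] bil[rule_format, of 3 3]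
    by (simp_all add: bilinear_part_def idx_ends(1) coord)
  \<comment> \<open>\<open>\<Lambda>\<^sup>2 L \<otimes> \<Lambda>\<^sup>2 L\<^sup>*\<close>, first \<open>t\<^sub>i t\<^sub>j\<^sup>* t\<^sub>k t\<^sub>k\<^sup>*\<close> with distinct indices, then the three \<open>t\<^sub>i t\<^sub>i\<^sup>* t\<^sub>j t\<^sub>j\<^sup>*\<close>; a
    contraction equal to \<open>l \<epsilon>\<close> leaves \<open>l / 4\<close> times \<open>\<epsilon>\<^sup>2\<close>\<close>
  have kz:
    "c $ idx True False True False True True = 0"
    "c $ idx True True True False True False = 0"
    "c $ idx False True True True False True = 0"
    "c $ idx True True True True False False = 0"
    "c $ idx False True False True True True = 0"
    "c $ idx True False False True True True = 0"
    using con[rule_format, of 1 2] con[rule_format, of 1 3] con[rule_format, of 2 1] con[rule_format, of 2 3] con[rule_format, of 3 1] con[rule_format, of 3 2]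
    by (simp_all add: bilinear_part_def eps_contraction_def sum_3 idx_ends(1) coord)
  have k: "- c $ idx True True False True True False + c $ idx True False True True False True = l"
    "- c $ idx True True False True True False + c $ idx False True True False True True = l"
    "c $ idx True False True True False True + c $ idx False True True False True True = l"
    using con[rule_format, of 1 1] con[rule_format, of 2 2] con[rule_format, of 3 3]
    by (simp_all add: bilinear_part_def eps_contraction_def sum_3 idx_ends(1) coord)
  have solve: "x = - (l / 2) \<and> y = l / 2 \<and> z = l / 2" if "- x + y = l" "- x + z = l" "y + z = l" for x y z
  proof -
    have "z = y" using that(1,2) by (metis add_left_cancel)
    then have y: "y = l / 2" using that(3) by (simp add: field_simps)
    have "x = y - l" using that(1) by (metis add_uminus_conv_diff diff_add_cancel minus_diff_eq uminus_add_conv_diff)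
    then show ?thesis using y \<open>z = y\<close> by simp
  qed
  have kd: "c $ idx True True False True True False = - (l / 2)" "c $ idx True False True True False True = l / 2" "c $ idx False True True False True True = l / 2"
    using solve[OF k] by blast+
  note tt = top[unfolded idx_ends] c0[unfolded idx_ends]
  \<comment> \<open>\<open>\<alpha>\<close> and \<open>- \<beta>\<close> are the coefficients of \<open>t\<^sub>i\<^sub>+\<^sub>1 t\<^sub>i\<^sub>+\<^sub>2\<close> and of \<open>\<mu> t\<^sub>i\<^sup>*\<close>\<close>
  define \<alpha> where "\<alpha> i = dv (lagr (i + 2)) (dv (lagr (i + 1)) c) $ ({}, {})" for i
  define \<beta> where "\<beta> i = - dv (gdual (lagr i)) (dv (lagr 3) (dv (lagr 2) (dv (lagr 1) c))) $ ({}, {})" for i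
  define w :: "('k, heis) cochain" where "w =
    (\<Sum>i\<in>UNIV. \<alpha> i *s gen (gdual (lagr i))) +
    (\<Sum>i\<in>UNIV. \<beta> i *s (gen (lagr (i + 1)) \<or>\<^sub>C (gen (gdual (lagr (i + 1))) \<or>\<^sub>C gen (gdual (lagr i))))) -
    (l / 2) *s (gen (gdual (lagr 1)) \<or>\<^sub>C (gen (gdual (lagr 2)) \<or>\<^sub>C gen (gdual (lagr 3))))"
  have w: "w = \<alpha> 1 *s gen (Inr X\<^sub>1) + \<alpha> 2 *s gen (Inr X\<^sub>m\<^sub>1) + \<alpha> 3 *s gen (Inl H\<^sub>0)
    + \<beta> 1 *s (gen (Inl X\<^sub>m\<^sub>1) \<or>\<^sub>C (gen (Inr X\<^sub>m\<^sub>1) \<or>\<^sub>C gen (Inr X\<^sub>1)))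
    + \<beta> 2 *s (gen (Inr H\<^sub>0) \<or>\<^sub>C (gen (Inl H\<^sub>0) \<or>\<^sub>C gen (Inr X\<^sub>m\<^sub>1)))
    + \<beta> 3 *s (gen (Inl X\<^sub>1) \<or>\<^sub>C (gen (Inr X\<^sub>1) \<or>\<^sub>C gen (Inl H\<^sub>0)))
    - (l / 2) *s (gen (Inr X\<^sub>1) \<or>\<^sub>C (gen (Inr X\<^sub>m\<^sub>1) \<or>\<^sub>C gen (Inl H\<^sub>0)))"
    by (simp add: w_def sum_3 add.assoc)
  have ab: "\<alpha> 1 = dv (Inr H\<^sub>0) (dv (Inl X\<^sub>m\<^sub>1) c) $ ({}, {})"
    "\<alpha> 2 = dv (Inl X\<^sub>1) (dv (Inr H\<^sub>0) c) $ ({}, {})"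
    "\<alpha> 3 = dv (Inl X\<^sub>m\<^sub>1) (dv (Inl X\<^sub>1) c) $ ({}, {})"
    "\<beta> 1 = - dv (Inr X\<^sub>1) (dv (Inr H\<^sub>0) (dv (Inl X\<^sub>m\<^sub>1) (dv (Inl X\<^sub>1) c))) $ ({}, {})"
    "\<beta> 2 = - dv (Inr X\<^sub>m\<^sub>1) (dv (Inr H\<^sub>0) (dv (Inl X\<^sub>m\<^sub>1) (dv (Inl X\<^sub>1) c))) $ ({}, {})"
    "\<beta> 3 = - dv (Inl H\<^sub>0) (dv (Inr H\<^sub>0) (dv (Inl X\<^sub>m\<^sub>1) (dv (Inl X\<^sub>1) c))) $ ({}, {})"
    by (simp_all add: \<alpha>_def \<beta>_def)
  note witness_coeffs = ab[unfolded idx_ends, simplified coord, simplified]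
  have w_odd: "w \<in> odd_cochains"
    unfolding w by (simp add: odd_cochains_def inv_gen_vee inv_gen)
  have "ce_diff heisenberg w $ idx a b d x y h = c $ idx a b d x y h" for a b d x y h
    unfolding w
    by (cases a; cases b; cases d; cases x; cases y; cases h;
       simp add: ce_diff_heisenberg_explicit dv_linear dv_diff coord gen_coord witness_coeffs odd0 cz pz kz kd tt)
  then have "c = ce_diff heisenberg w" by (simp add: cochain_eq_iff)
  with w_odd show ?thesis by (simp add: even_coboundaries_eq)
qed

section \<open>The isomorphism\<close>

definition class_of :: "('k ^ 3 ^ 3) \<times> ('k ^ 3 ^ 3) \<Rightarrow> ('k::field_char_0, heis) cochain set" where
  "class_of = (\<lambda>(A, B). cocycle_of A B +o even_coboundaries heisenberg)"

theorem corollary3p4: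
  shows "(even_cohomology heisenberg :: ('k::field_char_0, ('k, heis) cochain set) lie_struct)
    \<simeq>\<^sub>L semidirect (gl :: ('k, 'k ^ 3 ^ 3) lie_struct) (lbracket gl) (underlying_abelian gl)"
proof (rule lie_isomorphic_transport[OF semidirect_gl_lie_algebra])
  show "bij_betw class_of (lcarrier (semidirect (gl :: ('k, 'k ^ 3 ^ 3) lie_struct) (lbracket gl) (underlying_abelian gl)))
     (lcarrier (even_cohomology heisenberg))"
    unfolding bij_betw_def
  proof
    have "x = y" if eq: "class_of x = class_of y" for x y :: "('k ^ 3 ^ 3) \<times> ('k ^ 3 ^ 3)"
    proof -
      obtain w where w: "cocycle_of (fst x) (snd x) - cocycle_of (fst y) (snd y) = ce_diff heisenberg w"
        using eq by (auto simp: class_of_def split_beta coset_eq_iff) (auto simp: even_coboundaries_eq)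
      show ?thesis
        using arg_cong[OF w, of gl_part] arg_cong[OF w, of abelian_part]
        by (simp add: parts_diff gl_part_cocycle_of abelian_part_cocycle_of gl_part_ce_diff abelian_part_ce_diff prod_eq_iff)
    qed
    then show "inj_on class_of (lcarrier (semidirect (gl :: ('k, 'k ^ 3 ^ 3) lie_struct) (lbracket gl) (underlying_abelian gl)))"
      by (auto simp: inj_on_def)
    have "z +o even_coboundaries heisenberg \<in> range class_of" if z: "z \<in> even_cocycles heisenberg" for z :: "('k, heis) cochain"
    proof -
      let ?r = "cocycle_of (gl_part z) (abelian_part z)"
      have "z - ?r \<in> even_cocycles heisenberg"
        using z cocycle_of_cocycle[of "gl_part z" "abelian_part z"] ce_diff_linear(1)[of heisenberg "z - ?r" ?r]
        by (simp add: even_cocycles_def)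
      then have "z - ?r \<in> even_coboundaries heisenberg"
        by (rule even_cocycle_exact) (simp_all add: parts_diff gl_part_cocycle_of abelian_part_cocycle_of)
      then have "z +o even_coboundaries heisenberg = class_of (gl_part z, abelian_part z)"
        by (simp add: class_of_def coset_eq_iff)
      then show ?thesis by blast
    qed
    then show "class_of ` lcarrier (semidirect (gl :: ('k, 'k ^ 3 ^ 3) lie_struct) (lbracket gl) (underlying_abelian gl)) =
       lcarrier (even_cohomology heisenberg)"
      using cocycle_of_cocycle by (force simp: semidirect_gl even_cohomology_carrier class_of_def)
  qed
qed (auto simp: semidirect_gl class_of_def even_cohomology_operations[OF coboundaries_cocycles] cocycle_of_cocycle poisson_cocycle_of poisson_eq cocycle_of_linear)

end
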